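(* Let $(M^n,g)$ be a compact connected Riemannian manifold of dimension $n\ge 2$, with or without boundary, and let $\delta\in(0,1)$. There exist $\lambda_0>0$ and a constant $k_{g,\delta,\lambda_0}>0$ such that for every eigenvalue $\lambda\ge\lambda_0$ of $\Delta_g$ (with Dirichlet boundary conditions if $\partial M\ne\emptyset$), every eigenfunction $u_\lambda$ associated to $\lambda$, and every nodal domain $A_i$ of $u_\lambda$, $$\operatorname{Vol}_g(V^i_\delta)\ \ge\ k_{g,\delta,\lambda_0}\,\lambda^{-\frac n2},\qquad V^i_\delta=\{x\in A_i : |u_\lambda(x)|\ge\delta\,\|u_\lambda\|_{L^\infty(A_i)}\}.$$
   Context: $\Delta_g=-\operatorname{div}_g\nabla_g$ is the Laplace–Beltrami operator with the sign making it non-negative. Eigenfunctions are real-valued and not identically zero: $\Delta_g u_\lambda=\lambda u_\lambda$ on $M$ if $M$ has no boundary, and $\Delta_g u_\lambda=\lambda u_\lambda$ in $M$, $u_\lambda=0$ on $\partial M$, if $M$ has boundary. A nodal domain of $u_\lambda$ is a maximal connected open subset of $\{u_\lambda\ne 0\}$. $\operatorname{Vol}_g$ is Riemannian volume. *)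

theory Defs
  imports "HOL-Analysis.Analysis" "HOL-Probability.Essential_Supremum"
begin

section \<open>Smooth functions on subsets of Euclidean space\<close>

definition partial_deriv ::
  "'n::finite \<Rightarrow> (real^'n \<Rightarrow> 'b::real_normed_vector) \<Rightarrow> real^'n \<Rightarrow> 'b"
  where "partial_deriv i f x = frechet_derivative f (at x) (axis i 1)"

text \<open>The class \<open>C\<^sup>m\<close>; only to be used on open sets.\<close>

primrec Ck_on :: "nat \<Rightarrow> (real^'n::finite) set \<Rightarrow> (real^'n \<Rightarrow> 'b::real_normed_vector) \<Rightarrow> bool"
  where
    "Ck_on 0 W f \<longleftrightarrow> continuous_on W f"
  | "Ck_on (Suc m) W f \<longleftrightarrow> f differentiable_on W \<and> (\<forall>i. Ck_on m W (partial_deriv i f))"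

text \<open>On a set that need not be open (such as a relatively open subset of a half-space),
  a function is smooth if near each point it has a smooth extension to an open set.\<close>

definition smooth_on :: "(real^'n::finite) set \<Rightarrow> (real^'n \<Rightarrow> 'b::real_normed_vector) \<Rightarrow> bool"
  where "smooth_on S f \<longleftrightarrow>
    (\<forall>x\<in>S. \<exists>W F. open W \<and> x \<in> W \<and> (\<forall>m. Ck_on m W F) \<and> (\<forall>y\<in>W \<inter> S. F y = f y))"


section \<open>Riemannian manifolds with (possibly empty) boundary\<close>

text \<open>A chart is a pair of a domain and a coordinate map; the values of the coordinate map
  outside the domain are irrelevant.  Charts take values in the closed half-space
  \<open>x $ k \<ge> 0\<close>, where \<open>k\<close> is the component \<open>bdry_coord\<close>: the index type carries no order, so
  there is no canonical last coordinate.  The component \<open>metric\<close> gives, for each chart of the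
  atlas, the matrix of the Riemannian metric in that chart, as a function of the coordinates.
  The manifold is a subset \<open>points\<close> of an ambient Hausdorff space and carries the subspace
  topology.\<close>

type_synonym ('a, 'n) chart = "'a set \<times> ('a \<Rightarrow> real^'n)"

record ('a, 'n::finite) riem =
  points :: "'a set"
  bdry_coord :: 'n
  atlas :: "('a, 'n) chart set"
  metric :: "('a, 'n) chart \<Rightarrow> real^'n \<Rightarrow> real^'n^'n"

abbreviation chart_dom :: "('a, 'n::finite) chart \<Rightarrow> 'a set"
  where "chart_dom c \<equiv> fst c"

abbreviation coord :: "('a, 'n::finite) chart \<Rightarrow> 'a \<Rightarrow> real^'n"
  where "coord c \<equiv> snd c"

definition chart_img :: "('a, 'n::finite) chart \<Rightarrow> (real^'n) set"
  where "chart_img c = coord c ` chart_dom c"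

definition param :: "('a, 'n::finite) chart \<Rightarrow> real^'n \<Rightarrow> 'a"
  where "param c = inv_into (chart_dom c) (coord c)"

definition half_space :: "'n::finite \<Rightarrow> (real^'n) set"
  where "half_space k = {x. 0 \<le> x $ k}"

definition is_chart :: "'a::topological_space set \<Rightarrow> 'n::finite \<Rightarrow> ('a, 'n) chart \<Rightarrow> bool"
  where "is_chart M k c \<longleftrightarrow>
    openin (top_of_set M) (chart_dom c) \<and>
    openin (top_of_set (half_space k)) (chart_img c) \<and>
    homeomorphism (chart_dom c) (chart_img c) (coord c) (param c)"

definition transition ::
  "('a, 'n::finite) chart \<Rightarrow> ('a, 'n) chart \<Rightarrow> real^'n \<Rightarrow> real^'n"
  where "transition c d = coord d \<circ> param c"

definition overlap :: "('a, 'n::finite) chart \<Rightarrow> ('a, 'n) chart \<Rightarrow> (real^'n) set"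
  where "overlap c d = coord c ` (chart_dom c \<inter> chart_dom d)"

definition smooth_manifold :: "('a::t2_space, 'n::finite) riem \<Rightarrow> bool"
  where "smooth_manifold X \<longleftrightarrow>
    (\<forall>c\<in>atlas X. is_chart (points X) (bdry_coord X) c) \<and>
    (\<Union>c\<in>atlas X. chart_dom c) = points X \<and>
    (\<forall>c\<in>atlas X. \<forall>d\<in>atlas X. smooth_on (overlap c d) (transition c d))"

text \<open>In the transformation law the derivative is taken within \<open>overlap c d\<close>, so that it also
  makes sense (and is unique) at boundary points.\<close>

definition riemannian_manifold :: "('a::t2_space, 'n::finite) riem \<Rightarrow> bool"
  where "riemannian_manifold X \<longleftrightarrow>
    smooth_manifold X \<and>
    (\<forall>c\<in>atlas X.
       smooth_on (chart_img c) (metric X c) \<and>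
       (\<forall>x\<in>chart_img c. transpose (metric X c x) = metric X c x \<and>
          (\<forall>v. v \<noteq> 0 \<longrightarrow> 0 < v \<bullet> (metric X c x *v v)))) \<and>
    (\<forall>c\<in>atlas X. \<forall>d\<in>atlas X. \<forall>x\<in>overlap c d. \<forall>J.
       (transition c d has_derivative (\<lambda>v. J *v v)) (at x within overlap c d) \<longrightarrow>
       metric X c x = transpose J ** metric X d (transition c d x) ** J)"

definition boundary_points :: "('a, 'n::finite) riem \<Rightarrow> 'a set"
  where "boundary_points X =
    {p. \<exists>c\<in>atlas X. p \<in> chart_dom c \<and> coord c p $ bdry_coord X = 0}"

text \<open>The coordinates of the interior points of the manifold in a chart; an open set.\<close>

definition int_img :: "('a, 'n::finite) riem \<Rightarrow> ('a, 'n) chart \<Rightarrow> (real^'n) set"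
  where "int_img X c = {x \<in> chart_img c. 0 < x $ bdry_coord X}"


section \<open>Riemannian volume\<close>

definition volume_density :: "('a, 'n::finite) riem \<Rightarrow> ('a, 'n) chart \<Rightarrow> real^'n \<Rightarrow> real"
  where "volume_density X c x = sqrt (det (metric X c x))"

text \<open>The measure \<open>B \<mapsto> \<integral> sqrt (det g) dx\<close> over \<open>coord c ` (B \<inter> chart_dom c)\<close>.\<close>

definition chart_volume ::
  "('a::topological_space, 'n::finite) riem \<Rightarrow> ('a, 'n) chart \<Rightarrow> 'a measure"
  where "chart_volume X c =
    distr (density lborel (\<lambda>x. ennreal (volume_density X c x) * indicator (chart_img c) x))
      borel (param c)"

text \<open>The chart volumes agree on overlaps of charts.  The Borel measure on the manifold that
  restricts to each of them is their least upper bound in the lattice of measures: it dominates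
  all of them, and cutting a Borel set into pieces that lie in single charts shows that it is
  below every other upper bound.  As a measure on the ambient type, it is supported on
  \<open>points X\<close>.\<close>

definition riemannian_volume :: "('a::topological_space, 'n::finite) riem \<Rightarrow> 'a measure"
  where "riemannian_volume X = (SUP c\<in>atlas X. chart_volume X c)"


section \<open>Laplace--Beltrami operator, eigenfunctions and nodal domains\<close>

text \<open>Gradient, divergence and \<open>\<Delta> = - div \<nabla>\<close> in the coordinates of a chart \<open>c\<close>.\<close>

definition grad_coord ::
  "('a, 'n::finite) riem \<Rightarrow> ('a, 'n) chart \<Rightarrow> (real^'n \<Rightarrow> real) \<Rightarrow> real^'n \<Rightarrow> real^'n"
  where "grad_coord X c f x = matrix_inv (metric X c x) *v (\<chi> j. partial_deriv j f x)"

definition div_coord ::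
  "('a, 'n::finite) riem \<Rightarrow> ('a, 'n) chart \<Rightarrow> (real^'n \<Rightarrow> real^'n) \<Rightarrow> real^'n \<Rightarrow> real"
  where "div_coord X c V x =
    (\<Sum>i\<in>UNIV. partial_deriv i (\<lambda>y. volume_density X c y * V y $ i) x) / volume_density X c x"

definition laplace_coord ::
  "('a, 'n::finite) riem \<Rightarrow> ('a, 'n) chart \<Rightarrow> (real^'n \<Rightarrow> real) \<Rightarrow> real^'n \<Rightarrow> real"
  where "laplace_coord X c f x = - div_coord X c (grad_coord X c f) x"

text \<open>Classical solutions: continuous up to the boundary and \<open>C\<^sup>2\<close> in the interior.  The
  boundary condition is void if the manifold has no boundary.\<close>

definition eigenfunction ::
  "('a::t2_space, 'n::finite) riem \<Rightarrow> real \<Rightarrow> ('a \<Rightarrow> real) \<Rightarrow> bool"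
  where "eigenfunction X lam u \<longleftrightarrow>
    (\<exists>p\<in>points X. u p \<noteq> 0) \<and>
    continuous_on (points X) u \<and>
    (\<forall>c\<in>atlas X. Ck_on 2 (int_img X c) (u \<circ> param c) \<and>
       (\<forall>x\<in>int_img X c. laplace_coord X c (u \<circ> param c) x = lam * u (param c x))) \<and>
    (\<forall>p\<in>boundary_points X. u p = 0)"

definition eigenvalue :: "('a::t2_space, 'n::finite) riem \<Rightarrow> real \<Rightarrow> bool"
  where "eigenvalue X lam \<longleftrightarrow> (\<exists>u. eigenfunction X lam u)"

definition connected_open_in_nonzero ::
  "('a::t2_space, 'n::finite) riem \<Rightarrow> ('a \<Rightarrow> real) \<Rightarrow> 'a set \<Rightarrow> bool"
  where "connected_open_in_nonzero X u A \<longleftrightarrow>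
    A \<noteq> {} \<and> connected A \<and> openin (top_of_set (points X)) A \<and> A \<subseteq> {p \<in> points X. u p \<noteq> 0}"

definition nodal_domain ::
  "('a::t2_space, 'n::finite) riem \<Rightarrow> ('a \<Rightarrow> real) \<Rightarrow> 'a set \<Rightarrow> bool"
  where "nodal_domain X u A \<longleftrightarrow>
    connected_open_in_nonzero X u A \<and>
    (\<forall>B. connected_open_in_nonzero X u B \<and> A \<subseteq> B \<longrightarrow> B = A)"

definition Linf_norm ::
  "('a::t2_space, 'n::finite) riem \<Rightarrow> 'a set \<Rightarrow> ('a \<Rightarrow> real) \<Rightarrow> ereal"
  where "Linf_norm X A u = esssup (restrict_space (riemannian_volume X) A) (\<lambda>p. ereal \<bar>u p\<bar>)"

definition superlevel ::
  "('a::t2_space, 'n::finite) riem \<Rightarrow> real \<Rightarrow> ('a \<Rightarrow> real) \<Rightarrow> 'a set \<Rightarrow> 'a set"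
  where "superlevel X \<delta> u A = {p \<in> A. ereal \<bar>u p\<bar> \<ge> ereal \<delta> * Linf_norm X A u}"

end

theory Submission
  imports Defs
begin

text \<open>The Alexandrov--Bakelman--Pucci argument gives the estimate without any integration by
  parts. Let \<open>x\<^sub>0\<close> be a maximum point of \<open>|u|\<close> on the nodal domain \<open>A\<close>, put
  \<open>m = |u x\<^sub>0|\<close>, \<open>h = (1 - \<delta>) m\<close>, \<open>r = \<lambda>\<^sup>-\<^sup>1\<^sup>/\<^sup>2\<close>, \<open>\<kappa> = h / r\<^sup>2\<close>, and let \<open>f = \<plusminus>u\<close> be positive on \<open>A\<close>, read
  in a chart. For every \<open>p\<close> with \<open>|p| < h / (2 r)\<close> the function
  \<open>f x - p \<bullet> (x - x\<^sub>0) - (\<kappa> / 2) |x - x\<^sub>0|\<^sup>2\<close> is smaller on the rim of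
  \<open>{x \<in> A. f x > \<delta> m \<and> |x - x\<^sub>0| < r}\<close> than at \<open>x\<^sub>0\<close>, so it has an interior maximum there.
  At such a contact point \<open>\<nabla>f = p + \<kappa> (x - x\<^sub>0)\<close> and \<open>N = \<kappa> I - D\<^sup>2f\<close> is positive semidefinite, and the
  eigenvalue equation, with \<open>\<lambda> r\<^sup>2 = 1\<close>, bounds its trace by a multiple of \<open>\<kappa>\<close>. Hence
  \<open>x \<mapsto> \<kappa> (x - x\<^sub>0) - \<nabla>f x\<close> maps the contact set onto a ball of radius \<open>h / (2 r) = \<kappa> r / 2\<close> with
  Jacobian at most \<open>const \<cdot> \<kappa>\<^sup>n\<close>, and the contact set has volume at least \<open>const \<cdot> r\<^sup>n\<close>. Near the
  boundary nothing changes, because \<open>f > \<delta> m > 0\<close> keeps the contact set in the interior.\<close>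

section \<open>Linear algebra and second derivatives\<close>

text \<open>Symmetric Gaussian elimination: \<open>P\<close> is split into rank-one terms, one index at a time.\<close>

lemma trace_psd_mult_psd_nonneg_aux:
  fixes Q :: "real^'n^'n"
  assumes "finite S" and Q: "\<And>v. 0 \<le> v \<bullet> (Q *v v)"
    and "\<And>i j. P$i$j = P$j$i" and "\<And>v. 0 \<le> v \<bullet> (P *v v)"
    and "\<And>i j. i \<notin> S \<Longrightarrow> P$i$j = 0"
  shows "0 \<le> (\<Sum>i\<in>UNIV. \<Sum>j\<in>UNIV. P$i$j * Q$i$j)"
  using assms(1,3-)
proof (induction S arbitrary: P rule: finite_induct)
  case empty
  then show ?case by simp
next
  case (insert k S)
  note sym = insert.prems(1) and psd = insert.prems(2) and supp = insert.prems(3)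
  have col: "P *v axis k 1 = (\<chi> i. P$i$k)" for k
    by (simp add: matrix_vector_mult_basis column_def)
  have bil: "(v + t *\<^sub>R axis k 1) \<bullet> (P *v (v + t *\<^sub>R axis k 1))
      = v \<bullet> (P *v v) + 2 * t * (P *v v)$k + t\<^sup>2 * P$k$k" for v t k
  proof -
    have "v \<bullet> (P *v axis k 1) = (P *v v)$k"
      unfolding col by (simp add: matrix_vector_mult_def inner_vec_def sym[of k] mult.commute)
    moreover have "axis k 1 \<bullet> (P *v v) = (P *v v)$k" by (simp add: inner_axis')
    moreover have "axis k 1 \<bullet> (P *v axis k 1) = P$k$k" unfolding col by (simp add: inner_axis')
    ultimately show ?thesis
      by (simp add: matrix_vector_right_distrib matrix_vector_mult_scaleR inner_add_left
          inner_add_right power2_eq_square algebra_simps)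
  qed
  have diag: "0 \<le> P$k$k"
    using psd[of "axis k 1"] by (simp add: col inner_axis')
  show ?case
  proof (cases "P$k$k = 0")
    case True
    \<comment> \<open>A zero pivot forces a zero row: along
      \<open>axis j 1 + t *\<^sub>R axis k 1\<close> the form is affine in \<open>t\<close> with
      slope \<open>2 * P$k$j\<close>, and the value of \<open>t\<close> inserted below makes it
      -1.\<close>
    have "P$k$j = 0" for j
    proof (rule ccontr)
      assume nz: "P$k$j \<noteq> 0"
      have "0 \<le> P$j$j + 2 * t * P$k$j" for t
        using psd[of "axis j 1 + t *\<^sub>R axis k 1"] True
        unfolding bil by (simp add: col inner_axis')
      from this[of "- (P$j$j + 1) / (2 * P$k$j)"] nz show False by (simp add: field_simps)
    qed
    then have "P$i$j = 0" if "i \<notin> S" for i j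
      using supp[of i j] that by (cases "i = k") auto
    then show ?thesis by (intro insert.IH sym psd)
  next
    case False
    with diag have pos: "P$k$k > 0" by simp
    \<comment> \<open>The Schur complement: subtracting the rank-one term with column
      \<open>q\<close> clears row and column \<open>k\<close>, which shrinks the support to
      \<open>S\<close>.\<close>
    define P' where "P' = (\<chi> i j. P$i$j - P$i$k * P$j$k / P$k$k)"
    define q where "q = (\<chi> i. P$i$k)"
    have qv: "(\<Sum>j\<in>UNIV. P$j$k * v$j) = (P *v v)$k" for v
      by (simp add: matrix_vector_mult_def sym[of k])
    \<comment> \<open>\<open>?c\<close> minimises the form of \<open>P\<close> over the line
      \<open>v + t *\<^sub>R axis k 1\<close>, and the minimum is exactly the form of
      \<open>P'\<close> at \<open>v\<close>.\<close>
    have "0 \<le> v \<bullet> (P' *v v)" for v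
    proof -
      let ?c = "- (P *v v)$k / P$k$k"
      have "(P' *v v)$i = (P *v v)$i - P$i$k * (P *v v)$k / P$k$k" for i
        unfolding P'_def qv[symmetric]
        by (simp add: matrix_vector_mult_def sum_subtractf sum_distrib_left sum_divide_distrib
            left_diff_distrib mult.assoc)
      then have "v \<bullet> (P' *v v) = v \<bullet> (P *v v) - (\<Sum>i\<in>UNIV. P$i$k * v$i) * (P *v v)$k / P$k$k"
        by (simp add: inner_vec_def sum_subtractf sum_distrib_left sum_distrib_right
            sum_divide_distrib right_diff_distrib mult.assoc mult.left_commute)
      also have "\<dots> = v \<bullet> (P *v v) - ((P *v v)$k)\<^sup>2 / P$k$k"
        by (simp add: qv power2_eq_square)
      also have "\<dots> = (v + ?c *\<^sub>R axis k 1) \<bullet> (P *v (v + ?c *\<^sub>R axis k 1))"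
        unfolding bil using pos by (simp add: power2_eq_square field_simps)
      also have "0 \<le> \<dots>" by (rule psd)
      finally show ?thesis .
    qed
    moreover have "P'$i$j = P'$j$i" for i j
      by (simp add: P'_def sym[of i j] mult.commute)
    moreover have "P'$i$j = 0" if "i \<notin> S" for i j
      using supp[of i] that pos by (cases "i = k") (auto simp: P'_def sym[of j k])
    ultimately have IH: "0 \<le> (\<Sum>i\<in>UNIV. \<Sum>j\<in>UNIV. P'$i$j * Q$i$j)"
      by (intro insert.IH)
    have qQ: "(\<Sum>i\<in>UNIV. \<Sum>j\<in>UNIV. P$i$k * P$j$k * Q$i$j) = q \<bullet> (Q *v q)"
      by (simp add: q_def inner_vec_def matrix_vector_mult_def sum_distrib_left mult_ac)
    have "(\<Sum>i\<in>UNIV. \<Sum>j\<in>UNIV. P$i$j * Q$i$j)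
        = (\<Sum>i\<in>UNIV. \<Sum>j\<in>UNIV. P'$i$j * Q$i$j + P$i$k * P$j$k * Q$i$j / P$k$k)"
      by (intro sum.cong refl) (simp add: P'_def algebra_simps)
    also have "\<dots> = (\<Sum>i\<in>UNIV. \<Sum>j\<in>UNIV. P'$i$j * Q$i$j) + q \<bullet> (Q *v q) / P$k$k"
      by (simp add: sum.distrib qQ[symmetric] sum_divide_distrib)
    finally show ?thesis
      using IH Q[of q] pos by simp
  qed
qed

lemma trace_psd_mult_psd_nonneg:
  fixes P Q :: "real^'n^'n"
  assumes "\<And>i j. P$i$j = P$j$i" "\<And>v. 0 \<le> v \<bullet> (P *v v)" "\<And>v. 0 \<le> v \<bullet> (Q *v v)"
  shows "0 \<le> (\<Sum>i\<in>UNIV. \<Sum>j\<in>UNIV. P$i$j * Q$i$j)"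
  using trace_psd_mult_psd_nonneg_aux[of UNIV Q P] assms by simp

text \<open>Evaluating the form at the sum and at the difference of two basis vectors gives 2 |N_ij|
  \<le> N_ii + N_jj, and the other diagonal entries are nonnegative. This converts a trace bound
  into the entry bound that controls the Jacobian.\<close>

lemma psd_entry_le_trace:
  fixes N :: "real^'n^'n"
  assumes sym: "\<And>i j. N$i$j = N$j$i" and psd: "\<And>v. 0 \<le> v \<bullet> (N *v v)"
  shows "\<bar>N$i$j\<bar> \<le> (\<Sum>k\<in>UNIV. N$k$k)"
proof -
  have col: "N *v axis k 1 = (\<chi> i. N$i$k)" for k
    by (simp add: matrix_vector_mult_basis column_def)
  have diag: "0 \<le> N$k$k" for k
    using psd[of "axis k 1"] by (simp add: col inner_axis')
  show ?thesis
  proof (cases "i = j")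
    case True
    then show ?thesis
      using diag member_le_sum[of j UNIV "\<lambda>k. N$k$k"] by simp
  next
    case False
    have "0 \<le> N$i$i + N$j$j + 2 * N$i$j"
      using psd[of "axis i 1 + axis j 1"] sym[of i j]
      by (simp add: matrix_vector_right_distrib inner_add_left inner_add_right col inner_axis')
    moreover have "0 \<le> N$i$i + N$j$j - 2 * N$i$j"
      using psd[of "axis i 1 - axis j 1"] sym[of i j]
      by (simp add: matrix_vector_mult_diff_distrib inner_diff_left inner_diff_right col inner_axis')
    moreover have "N$i$i + N$j$j \<le> (\<Sum>k\<in>UNIV. N$k$k)"
      using sum_mono2[of UNIV "{i,j}" "\<lambda>k. N$k$k"] diag False by simp
    ultimately show ?thesis using diag[of i] diag[of j] by linarith
  qed
qed

text \<open>The Leibniz expansion has n! terms, each at most B^n in absolute value. The resulting n!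
  reappears in \<open>abp_const\<close>.\<close>

lemma abs_det_le:
  fixes A :: "real^'n^'n"
  assumes "\<And>i j. \<bar>A$i$j\<bar> \<le> B"
  shows "\<bar>det A\<bar> \<le> fact CARD('n) * B ^ CARD('n)"
proof -
  have "\<bar>det A\<bar> \<le> (\<Sum>p | p permutes (UNIV::'n set). \<bar>of_int (sign p) * (\<Prod>i\<in>UNIV. A$i$p i)\<bar>)"
    unfolding det_def by (rule sum_abs)
  also have "\<dots> \<le> (\<Sum>p | p permutes (UNIV::'n set). B ^ CARD('n))"
  proof (rule sum_mono)
    fix p
    have "\<bar>of_int (sign p) * (\<Prod>i\<in>UNIV. A$i$p i)\<bar> = (\<Prod>i\<in>UNIV. \<bar>A$i$p i\<bar>)"
      by (simp add: abs_mult abs_prod sign_def)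
    also have "\<dots> \<le> (\<Prod>i\<in>(UNIV::'n set). B)"
      by (intro prod_mono) (use assms in auto)
    finally show "\<bar>of_int (sign p) * (\<Prod>i\<in>UNIV. A$i$p i)\<bar> \<le> B ^ CARD('n)" by simp
  qed
  also have "\<dots> = fact CARD('n) * B ^ CARD('n)"
    by (simp add: card_permutations)
  finally show ?thesis .
qed

section \<open>Second differences, symmetry of the second derivative, and its sign at a
  maximum\<close>

lemma has_real_derivative_along_line:
  fixes f :: "'a::real_inner \<Rightarrow> real"
  assumes "(f has_derivative (\<lambda>v. g \<bullet> v)) (at (x + s *\<^sub>R v))"
  shows "((\<lambda>s. f (x + s *\<^sub>R v)) has_real_derivative g \<bullet> v) (at s)"
proof -
  have "((\<lambda>s. f (x + s *\<^sub>R v)) has_derivative (\<lambda>h. g \<bullet> (h *\<^sub>R v))) (at s)"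
    by (rule has_derivative_compose[where f="\<lambda>s. x + s *\<^sub>R v", OF _ assms])
       (auto intro!: derivative_eq_intros)
  then show ?thesis
    unfolding has_field_derivative_def by (rule has_derivative_eq_rhs) (auto simp: mult.commute)
qed

text \<open>The mean value theorem in the direction \<open>v\<close> turns the mixed second
  difference into a difference of two values of \<open>G\<close>; each is linearised at
  \<open>x\<close> with error at most \<open>e\<close> times the distance to
  \<open>x\<close>.\<close>

lemma second_difference_estimate:
  fixes f :: "'a::real_inner \<Rightarrow> real" and G :: "'a \<Rightarrow> 'a"
  assumes "open S" "x \<in> S"
    and f: "\<And>y. y \<in> S \<Longrightarrow> (f has_derivative (\<lambda>v. G y \<bullet> v)) (at y)"
    and G: "(G has_derivative D) (at x)"
    and "0 < e"
  shows "\<exists>d>0. \<forall>t. 0 < t \<longrightarrow> t < d \<longrightarrow>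
    \<bar>f (x + t *\<^sub>R v + t *\<^sub>R w) - f (x + t *\<^sub>R v) - f (x + t *\<^sub>R w) + f x - t\<^sup>2 * (D w \<bullet> v)\<bar>
      \<le> 2 * e * (norm v + norm w)\<^sup>2 * t\<^sup>2"
proof -
  have linD: "linear D" using G has_derivative_linear by blast
  obtain d1 where d1: "d1 > 0" "ball x d1 \<subseteq> S"
    using assms open_contains_ball by blast
  obtain d2 where d2: "d2 > 0"
    "\<And>y. norm (y - x) < d2 \<Longrightarrow> norm (G y - G x - D (y - x)) \<le> e * norm (y - x)"
    using G \<open>0 < e\<close> unfolding has_derivative_at_alt by blast
  define R where "R = norm v + norm w"
  \<comment> \<open>For \<open>t < d\<close> the whole parallelogram spanned by
    \<open>t *\<^sub>R v\<close> and \<open>t *\<^sub>R w\<close> stays within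
    \<open>min d1 d2\<close> of \<open>x\<close>; the summand 1 covers the case
    \<open>R = 0\<close>.\<close>
  define d where "d = min d1 d2 / (R + 1)"
  have R: "0 \<le> R" by (simp add: R_def)
  show ?thesis
  proof (intro exI[of _ d] conjI allI impI)
    show "0 < d" using d1 d2 R by (simp add: d_def)
    fix t :: real
    assume t: "0 < t" "t < d"
    have tR: "t * R < min d1 d2"
    proof -
      have "t * R \<le> t * (R + 1)" using t by simp
      also have "\<dots> < min d1 d2" using t R by (simp add: d_def field_simps)
      finally show ?thesis .
    qed
    have near: "norm (s *\<^sub>R v + s' *\<^sub>R w) \<le> t * R" if "0 \<le> s" "s \<le> t" "0 \<le> s'" "s' \<le> t" for s s'
    proof -
      have "norm (s *\<^sub>R v + s' *\<^sub>R w) \<le> s * norm v + s' * norm w"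
        using norm_triangle_ineq[of "s *\<^sub>R v" "s' *\<^sub>R w"] that by simp
      also have "\<dots> \<le> t * norm v + t * norm w"
        using that by (intro add_mono mult_right_mono) auto
      finally show ?thesis by (simp add: R_def distrib_left)
    qed
    have inS: "x + s *\<^sub>R v + s' *\<^sub>R w \<in> S" if "0 \<le> s" "s \<le> t" "0 \<le> s'" "s' \<le> t" for s s'
    proof -
      have "x + s *\<^sub>R v + s' *\<^sub>R w \<in> ball x d1"
        using near[OF that] tR norm_minus_cancel[of "s *\<^sub>R v + s' *\<^sub>R w"]
        by (simp add: dist_norm add.assoc)
      then show ?thesis using d1 by blast
    qed
    define g where "g s = f (x + s *\<^sub>R v + t *\<^sub>R w) - f (x + s *\<^sub>R v)" for s
    have g': "(g has_real_derivative (G (x + s *\<^sub>R v + t *\<^sub>R w) - G (x + s *\<^sub>R v)) \<bullet> v) (at s)"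
      if "0 \<le> s" "s \<le> t" for s
    proof -
      have "((\<lambda>s. f ((x + t *\<^sub>R w) + s *\<^sub>R v)) has_real_derivative G (x + s *\<^sub>R v + t *\<^sub>R w) \<bullet> v) (at s)"
        using f[OF inS[of s t]] that t
        by (intro has_real_derivative_along_line) (simp add: add.commute add.left_commute)
      moreover have "((\<lambda>s. f (x + s *\<^sub>R v)) has_real_derivative G (x + s *\<^sub>R v) \<bullet> v) (at s)"
        using f[OF inS[of s 0]] that t by (intro has_real_derivative_along_line) simp
      ultimately have "((\<lambda>s. f ((x + t *\<^sub>R w) + s *\<^sub>R v) - f (x + s *\<^sub>R v)) has_real_derivative
          (G (x + s *\<^sub>R v + t *\<^sub>R w) \<bullet> v - G (x + s *\<^sub>R v) \<bullet> v)) (at s)"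
        by (rule DERIV_diff)
      moreover have "g = (\<lambda>s. f ((x + t *\<^sub>R w) + s *\<^sub>R v) - f (x + s *\<^sub>R v))"
        by (simp add: g_def fun_eq_iff add.assoc add.commute[of "t *\<^sub>R w"])
      ultimately show ?thesis
        by (simp only: inner_diff_left)
    qed
    obtain \<xi> where \<xi>: "0 < \<xi>" "\<xi> < t"
      and gt: "g t - g 0 = (t - 0) * ((G (x + \<xi> *\<^sub>R v + t *\<^sub>R w) - G (x + \<xi> *\<^sub>R v)) \<bullet> v)"
      using MVT2[OF \<open>0 < t\<close> g'] by metis
    have e1: "norm (G (x + \<xi> *\<^sub>R v + t *\<^sub>R w) - G x - D (\<xi> *\<^sub>R v + t *\<^sub>R w)) \<le> e * (t * R)"
    proof -
      have n: "norm (\<xi> *\<^sub>R v + t *\<^sub>R w) \<le> t * R" using near[of \<xi> t] \<xi> by simp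
      have "norm (G (x + \<xi> *\<^sub>R v + t *\<^sub>R w) - G x - D (\<xi> *\<^sub>R v + t *\<^sub>R w)) \<le> e * norm (\<xi> *\<^sub>R v + t *\<^sub>R w)"
        using d2(2)[of "x + \<xi> *\<^sub>R v + t *\<^sub>R w"] n tR by (simp add: add.assoc)
      also have "\<dots> \<le> e * (t * R)" using n \<open>0 < e\<close> by simp
      finally show ?thesis .
    qed
    have e2: "norm (G (x + \<xi> *\<^sub>R v) - G x - D (\<xi> *\<^sub>R v)) \<le> e * (t * R)"
    proof -
      have n: "norm (\<xi> *\<^sub>R v) \<le> t * R" using near[of \<xi> 0] \<xi> by simp
      have "norm (G (x + \<xi> *\<^sub>R v) - G x - D (\<xi> *\<^sub>R v)) \<le> e * norm (\<xi> *\<^sub>R v)"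
        using d2(2)[of "x + \<xi> *\<^sub>R v"] n tR by simp
      also have "\<dots> \<le> e * (t * R)" using n \<open>0 < e\<close> by simp
      finally show ?thesis .
    qed
    define E where "E = G (x + \<xi> *\<^sub>R v + t *\<^sub>R w) - G (x + \<xi> *\<^sub>R v) - t *\<^sub>R D w"
    define E1 where "E1 = G (x + \<xi> *\<^sub>R v + t *\<^sub>R w) - G x - D (\<xi> *\<^sub>R v + t *\<^sub>R w)"
    define E2 where "E2 = G (x + \<xi> *\<^sub>R v) - G x - D (\<xi> *\<^sub>R v)"
    have "E = E1 - E2"
      using linD by (simp add: E_def E1_def E2_def linear_add linear_scale)
    then have nE: "norm E \<le> 2 * e * (t * R)"
      using e1[folded E1_def] e2[folded E2_def] norm_triangle_ineq4[of E1 E2] by simp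
    have "f (x + t *\<^sub>R v + t *\<^sub>R w) - f (x + t *\<^sub>R v) - f (x + t *\<^sub>R w) + f x = g t - g 0"
      by (simp add: g_def)
    also have "\<dots> = t * ((t *\<^sub>R D w + E) \<bullet> v)"
      using gt by (simp add: E_def)
    also have "\<dots> = t\<^sup>2 * (D w \<bullet> v) + t * (E \<bullet> v)"
      by (simp add: inner_add_left power2_eq_square algebra_simps)
    finally have "\<bar>f (x + t *\<^sub>R v + t *\<^sub>R w) - f (x + t *\<^sub>R v) - f (x + t *\<^sub>R w) + f x - t\<^sup>2 * (D w \<bullet> v)\<bar>
        = t * \<bar>E \<bullet> v\<bar>"
      using t by (simp add: abs_mult)
    also have "\<dots> \<le> t * (norm E * norm v)"
      using t Cauchy_Schwarz_ineq2[of E v] by simp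
    also have "\<dots> \<le> t * (2 * e * (t * R) * R)"
      using t nE \<open>0 < e\<close> R by (intro mult_left_mono mult_mono) (auto simp: R_def)
    finally show "\<bar>f (x + t *\<^sub>R v + t *\<^sub>R w) - f (x + t *\<^sub>R v) - f (x + t *\<^sub>R w) + f x - t\<^sup>2 * (D w \<bullet> v)\<bar>
      \<le> 2 * e * (norm v + norm w)\<^sup>2 * t\<^sup>2"
      by (simp add: R_def power2_eq_square mult_ac)
  qed
qed

text \<open>The second difference is unchanged when \<open>v\<close> and \<open>w\<close> are
  exchanged, yet it approximates both candidate values times t^2 up to o(t^2).\<close>

lemma second_derivative_symmetric:
  fixes f :: "'a::real_inner \<Rightarrow> real" and G :: "'a \<Rightarrow> 'a"
  assumes S: "open S" "x \<in> S"
    and f: "\<And>y. y \<in> S \<Longrightarrow> (f has_derivative (\<lambda>v. G y \<bullet> v)) (at y)"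
    and G: "(G has_derivative D) (at x)"
  shows "D v \<bullet> w = D w \<bullet> v"
proof (rule ccontr)
  assume ne: "D v \<bullet> w \<noteq> D w \<bullet> v"
  define R where "R = (norm v + norm w)\<^sup>2 + 1"
  define q where "q = \<bar>D v \<bullet> w - D w \<bullet> v\<bar>"
  \<comment> \<open>With this choice the two errors together amount to at most half of
    \<open>q\<close>, which contradicts \<open>q > 0\<close>.\<close>
  define e where "e = q / (8 * R)"
  have R: "R > 0" unfolding R_def using zero_le_power2[of "norm v + norm w"] by linarith
  have q: "q > 0" using ne by (simp add: q_def)
  have e: "e > 0" using R q by (simp add: e_def)
  obtain d1 where d1: "d1 > 0" "\<And>t. 0 < t \<Longrightarrow> t < d1 \<Longrightarrow>
    \<bar>f (x + t *\<^sub>R v + t *\<^sub>R w) - f (x + t *\<^sub>R v) - f (x + t *\<^sub>R w) + f x - t\<^sup>2 * (D w \<bullet> v)\<bar>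
      \<le> 2 * e * (norm v + norm w)\<^sup>2 * t\<^sup>2"
    using second_difference_estimate[OF S f G e, where v=v and w=w] by blast
  obtain d2 where d2: "d2 > 0" "\<And>t. 0 < t \<Longrightarrow> t < d2 \<Longrightarrow>
    \<bar>f (x + t *\<^sub>R w + t *\<^sub>R v) - f (x + t *\<^sub>R w) - f (x + t *\<^sub>R v) + f x - t\<^sup>2 * (D v \<bullet> w)\<bar>
      \<le> 2 * e * (norm w + norm v)\<^sup>2 * t\<^sup>2"
    using second_difference_estimate[OF S f G e, where v=w and w=v] by blast
  define t where "t = min d1 d2 / 2"
  have t: "0 < t" "t < d1" "t < d2" using d1 d2 by (auto simp: t_def)
  let ?\<Delta> = "f (x + t *\<^sub>R v + t *\<^sub>R w) - f (x + t *\<^sub>R v) - f (x + t *\<^sub>R w) + f x"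
  have 1: "\<bar>?\<Delta> - t\<^sup>2 * (D w \<bullet> v)\<bar> \<le> 2 * e * (norm v + norm w)\<^sup>2 * t\<^sup>2"
    using d1(2)[OF t(1,2)] .
  have swap: "x + t *\<^sub>R w + t *\<^sub>R v = x + t *\<^sub>R v + t *\<^sub>R w" by (simp add: algebra_simps)
  have 2: "\<bar>?\<Delta> - t\<^sup>2 * (D v \<bullet> w)\<bar> \<le> 2 * e * (norm v + norm w)\<^sup>2 * t\<^sup>2"
    using d2(2)[OF t(1,3)] unfolding swap add.commute[of "norm w" "norm v"]
    by (smt (verit))
  have "t\<^sup>2 * q = \<bar>t\<^sup>2 * (D v \<bullet> w) - t\<^sup>2 * (D w \<bullet> v)\<bar>"
    by (simp add: q_def right_diff_distrib[symmetric] abs_mult)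
  also have "\<dots> \<le> 4 * e * (norm v + norm w)\<^sup>2 * t\<^sup>2"
    using 1 2 by linarith
  finally have "q \<le> 4 * e * (norm v + norm w)\<^sup>2"
    using t by (simp add: mult.commute)
  also have "\<dots> \<le> 4 * e * R" using e by (simp add: R_def)
  also have "\<dots> = q / 2" using R by (simp add: e_def)
  finally show False using q by simp
qed

text \<open>Otherwise \<open>G \<bullet> v\<close>, which vanishes at \<open>x\<close>, would be
  positive just beyond \<open>x\<close> in the direction \<open>v\<close>, and by the mean value
  theorem \<open>f\<close> would exceed its maximum there.\<close>

lemma second_derivative_nonpos_at_max:
  fixes f :: "'a::real_inner \<Rightarrow> real" and G :: "'a \<Rightarrow> 'a"
  assumes S: "open S" "x \<in> S"
    and f: "\<And>y. y \<in> S \<Longrightarrow> (f has_derivative (\<lambda>v. G y \<bullet> v)) (at y)"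
    and G: "(G has_derivative D) (at x)"
    and max: "\<And>y. y \<in> S \<Longrightarrow> f y \<le> f x" and crit: "G x = 0"
  shows "D v \<bullet> v \<le> 0"
proof (rule ccontr)
  assume "\<not> D v \<bullet> v \<le> 0"
  then have pos: "D v \<bullet> v > 0" by simp
  have linD: "linear D" using G has_derivative_linear by blast
  have "((\<lambda>s. G (x + s *\<^sub>R v)) has_derivative (\<lambda>h. D (h *\<^sub>R v))) (at 0)"
    by (rule has_derivative_compose[where f="\<lambda>s. x + s *\<^sub>R v"])
       (use G in \<open>auto intro!: derivative_eq_intros\<close>)
  then have "((\<lambda>s. G (x + s *\<^sub>R v) \<bullet> v) has_real_derivative D v \<bullet> v) (at 0)"
    unfolding has_field_derivative_def
    by (auto intro!: derivative_eq_intros simp: linear_scale[OF linD] mult.commute)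
  from DERIV_pos_inc_right[OF this pos] obtain d1 where d1: "d1 > 0"
    "\<And>h. 0 < h \<Longrightarrow> h < d1 \<Longrightarrow> 0 < G (x + h *\<^sub>R v) \<bullet> v"
    using crit by auto
  obtain d2 where d2: "d2 > 0" "ball x d2 \<subseteq> S"
    using S open_contains_ball by blast
  define t where "t = min (d1/2) (d2 / (norm v + 1) / 2)"
  have nv: "norm v + 1 > 0" by (simp add: add_nonneg_pos)
  have t: "0 < t" "t < d1" "t * (norm v + 1) < d2"
  proof -
    show "0 < t" "t < d1" using d1 d2 nv by (auto simp: t_def)
    have "t \<le> d2 / (norm v + 1) / 2" unfolding t_def by (rule min.cobounded2)
    then have "t \<le> (d2 / 2) / (norm v + 1)" by (metis divide_divide_eq_left mult.commute)
    then have "t * (norm v + 1) \<le> d2 / 2" by (simp only: pos_le_divide_eq[OF nv])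
    then show "t * (norm v + 1) < d2" using d2 by simp
  qed
  have inS: "x + s *\<^sub>R v \<in> S" if "0 \<le> s" "s \<le> t" for s
  proof -
    have "s * norm v \<le> t * (norm v + 1)" using that nv by (intro mult_mono) auto
    then have "x + s *\<^sub>R v \<in> ball x d2" using t that by (simp add: dist_norm)
    then show ?thesis using d2 by blast
  qed
  have der: "((\<lambda>s. f (x + s *\<^sub>R v)) has_real_derivative G (x + s *\<^sub>R v) \<bullet> v) (at s)" if "0 \<le> s" "s \<le> t" for s
    using f[OF inS[OF that]] by (rule has_real_derivative_along_line)
  obtain \<xi> where \<xi>: "0 < \<xi>" "\<xi> < t"
    and eq: "f (x + t *\<^sub>R v) - f (x + 0 *\<^sub>R v) = (t - 0) * (G (x + \<xi> *\<^sub>R v) \<bullet> v)"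
    using MVT2[OF \<open>0 < t\<close> der] by metis
  have "0 < G (x + \<xi> *\<^sub>R v) \<bullet> v"
    using d1(2)[of \<xi>] \<xi> t by linarith
  then have "0 < (t - 0) * (G (x + \<xi> *\<^sub>R v) \<bullet> v)"
    using t by simp
  moreover have "f (x + t *\<^sub>R v) \<le> f (x + 0 *\<^sub>R v)"
    using max[OF inS[of t]] t by simp
  ultimately show False using eq by linarith
qed


section \<open>Images under differentiable maps\<close>

lemma emeasure_le_of_differentiable_cover_wellorder:
  fixes g :: "real^'n::{finite,wellorder} \<Rightarrow> real^'n::_" and A :: "real^'n::_ \<Rightarrow> real^'n::_^'n::_"
  assumes S: "S \<in> sets borel" "bounded S" and A: "continuous_on S A"
    and g: "\<And>x. x \<in> S \<Longrightarrow> (g has_derivative (\<lambda>v. A x *v v)) (at x)"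
    and B: "\<And>x i j. x \<in> S \<Longrightarrow> \<bar>A x$i$j\<bar> \<le> B" and T: "T \<in> sets borel" "T \<subseteq> g ` S"
  shows "emeasure lborel T \<le> ennreal (fact CARD('n) * B ^ CARD('n)) * emeasure lborel S"
proof -
  let ?B = "fact CARD('n) * B ^ CARD('n)"
  have S_lm: "S \<in> lmeasurable"
    using S by (intro bounded_set_imp_lmeasurable) auto
  have g': "(g has_derivative (\<lambda>v. A x *v v)) (at x within S)" if "x \<in> S" for x
    using g[OF that] by (rule has_derivative_at_withinI)
  have det_le: "\<bar>det (matrix (\<lambda>v. A x *v v))\<bar> \<le> ?B" if "x \<in> S" for x
    using abs_det_le[of "A x" B] B[OF that] by simp
  have "continuous_on S (\<lambda>x. \<bar>det (A x)\<bar>)"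
    unfolding det_def by (auto intro!: continuous_intros A)
  then have meas: "(\<lambda>x. \<bar>det (A x)\<bar>) \<in> borel_measurable (lebesgue_on S)"
    by (rule continuous_imp_measurable_on_sets_lebesgue) (rule fmeasurableD[OF S_lm])
  have "(\<lambda>x. \<bar>det (A x)\<bar>) integrable_on S"
    by (rule measurable_bounded_by_integrable_imp_integrable[OF meas integrable_on_const[OF S_lm]])
       (use det_le fmeasurableD[OF S_lm] in auto)
  then have int: "(\<lambda>x. \<bar>det (matrix (\<lambda>v. A x *v v))\<bar>) integrable_on S" by simp
  have img: "g ` S \<in> lmeasurable" "measure lebesgue (g ` S) \<le> ?B * measure lebesgue S"
    using measurable_bounded_differentiable_image[OF S_lm g' int det_le]
      measure_bounded_differentiable_image[OF S_lm g' int det_le] by blast+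
  \<comment> \<open>The empty case is separate because the sign of \<open>?B\<close> is read off
    from \<open>det_le\<close> at a point of \<open>S\<close>.\<close>
  show ?thesis
  proof (cases "S = {}")
    case True
    then show ?thesis using T by simp
  next
    case False
    then obtain x where "x \<in> S" by blast
    then have B0: "?B \<ge> 0" using det_le[of x] by linarith
    have "emeasure lborel T = emeasure lebesgue T" using T by simp
    also have "\<dots> \<le> emeasure lebesgue (g ` S)"
      using T img(1) by (intro emeasure_mono) (auto simp: fmeasurableD)
    also have "\<dots> = ennreal (measure lebesgue (g ` S))"
      using img(1) by (rule emeasure_eq_measure2)
    also have "\<dots> \<le> ennreal (?B * measure lebesgue S)"
      by (rule ennreal_leI[OF img(2)])
    also have "\<dots> = ennreal ?B * emeasure lebesgue S"
      using B0 by (simp only: ennreal_mult measure_nonneg emeasure_eq_measure2[OF S_lm])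
    also have "emeasure lebesgue S = emeasure lborel S" using S by simp
    finally show ?thesis .
  qed
qed

text \<open>The library states the area formula only for index types of class \<open>wellorder\<close>. The
  following copy of a finite type carries an arbitrary well-order, so that the formula can be
  transferred to every finite index type.\<close>

datatype 'a ordered_copy = Ordered_Copy (orig: 'a)

instance ordered_copy :: (finite) finite
proof
  have "(UNIV :: 'a ordered_copy set) \<subseteq> range Ordered_Copy"
    by (intro subsetI) (metis ordered_copy.collapse rangeI)
  then show "finite (UNIV :: 'a ordered_copy set)"
    by (rule finite_subset) (rule finite_imageI, rule finite)
qed

text \<open>Any injection will do; one is fixed so that the order of the natural numbers can be
  pulled back to \<open>ordered_copy\<close>.\<close>

definition finite_rank :: "'a::finite \<Rightarrow> nat" where
  "finite_rank = (SOME f. inj f)"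

lemma inj_finite_rank: "inj (finite_rank :: 'a::finite \<Rightarrow> nat)"
proof -
  have "\<exists>f :: 'a \<Rightarrow> nat. inj f"
    using finite_imp_inj_to_nat_seg[OF finite[of "UNIV :: 'a set"]] by blast
  then show ?thesis unfolding finite_rank_def by (rule someI_ex)
qed

instantiation ordered_copy :: (finite) wellorder
begin

definition "x \<le> y \<longleftrightarrow> finite_rank (orig x) \<le> finite_rank (orig y)"

definition "x < y \<longleftrightarrow> finite_rank (orig x) < finite_rank (orig y)"

instance
proof
  fix x y z :: "'a ordered_copy"
  show "x < y \<longleftrightarrow> x \<le> y \<and> \<not> y \<le> x"
    unfolding less_eq_ordered_copy_def less_ordered_copy_def by linarith
  show "x \<le> x"
    unfolding less_eq_ordered_copy_def by (rule order_refl)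
  show "x \<le> z" if "x \<le> y" "y \<le> z"
    using that unfolding less_eq_ordered_copy_def by (rule order_trans)
  show "x \<le> y \<or> y \<le> x"
    unfolding less_eq_ordered_copy_def by (rule linear)
  show "x = y" if "x \<le> y" "y \<le> x"
  proof (rule ordered_copy.expand)
    have "finite_rank (orig x) = finite_rank (orig y)"
      using that unfolding less_eq_ordered_copy_def by (rule order_antisym)
    then show "orig x = orig y" by (rule injD[OF inj_finite_rank])
  qed
next
  fix P :: "'a ordered_copy \<Rightarrow> bool" and a
  assume step: "\<And>x. (\<And>y. y < x \<Longrightarrow> P y) \<Longrightarrow> P x"
  show "P a"
  proof (induction a rule: measure_induct_rule[where f="\<lambda>x. finite_rank (orig x)"])
    case (less x)
    show ?case by (rule step) (rule less, unfold less_ordered_copy_def)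
  qed
qed

end

section \<open>Lebesgue measure under relabelling of coordinates\<close>

lemma bij_orig: "bij orig"
  by (rule o_bij[where g=Ordered_Copy]) auto

lemma card_ordered_copy: "CARD('a ordered_copy) = CARD('a)"
  using bij_betw_same_card[OF bij_orig] by simp

lemma ordered_copy_all: "(\<forall>i. P i) \<longleftrightarrow> (\<forall>i. P (Ordered_Copy i))"
  by (metis ordered_copy.collapse)

definition to_copy :: "real^'n \<Rightarrow> real^('n ordered_copy)" where
  "to_copy x = (\<chi> i. x $ orig i)"

definition of_copy :: "real^('n ordered_copy) \<Rightarrow> real^'n" where
  "of_copy x = (\<chi> i. x $ Ordered_Copy i)"

lemma to_of_copy [simp]: "to_copy (of_copy x) = x"
  by (simp add: to_copy_def of_copy_def vec_eq_iff)

lemma of_to_copy [simp]: "of_copy (to_copy x) = x"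
  by (simp add: to_copy_def of_copy_def vec_eq_iff)

lemma bounded_linear_to_copy: "bounded_linear to_copy"
  by (rule linear_conv_bounded_linear[THEN iffD1], rule linearI) (auto simp: to_copy_def vec_eq_iff)

lemma bounded_linear_of_copy: "bounded_linear of_copy"
  by (rule linear_conv_bounded_linear[THEN iffD1], rule linearI) (auto simp: of_copy_def vec_eq_iff)

lemma prod_Basis_cart: "(\<Prod>b\<in>Basis. v \<bullet> b) = (\<Prod>i\<in>UNIV. v$i)" for v :: "real^'n"
proof -
  have basis: "(Basis :: (real^'n) set) = (\<lambda>i. axis i 1) ` UNIV"
    by (auto simp: Basis_vec_def)
  have inj: "inj (\<lambda>i::'n. axis i (1::real))"
    by (auto simp: inj_def axis_eq_axis)
  show ?thesis
    unfolding basis prod.reindex[OF inj] by (simp add: inner_axis)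
qed

text \<open>Relabelling carries boxes to boxes with the same side lengths, and Lebesgue measure is
  determined by its values on boxes.\<close>

lemma distr_of_copy: "distr lborel borel (of_copy :: _ \<Rightarrow> real^'n) = lborel"
proof (rule lborel_eqI[symmetric])
  have meas: "(of_copy :: _ \<Rightarrow> real^'n) \<in> borel_measurable lborel"
    using borel_measurable_continuous_onI[OF linear_continuous_on[OF bounded_linear_of_copy]] by simp
  fix l u :: "real^'n" assume lu: "\<And>b. b \<in> Basis \<Longrightarrow> l \<bullet> b \<le> u \<bullet> b"
  then have le: "l$i \<le> u$i" for i
    using lu[of "axis i 1"] by (auto simp: Basis_vec_def inner_axis)
  have "x \<in> of_copy -` box l u \<longleftrightarrow> x \<in> box (to_copy l) (to_copy u)" for x
    unfolding vimage_eq mem_box_cart of_copy_def to_copy_def ordered_copy_all[of "\<lambda>i. _ i < x $ i \<and> _ i"]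
    by simp
  then have "of_copy -` box l u = box (to_copy l) (to_copy u)" by blast
  then have "emeasure (distr lborel borel of_copy) (box l u) = emeasure lborel (box (to_copy l) (to_copy u))"
    using meas by (simp add: emeasure_distr)
  also have "\<dots> = (\<Prod>b\<in>Basis. (to_copy u - to_copy l) \<bullet> b)"
    using le by (intro emeasure_lborel_box) (auto simp: Basis_vec_def inner_axis to_copy_def)
  also have "\<dots> = (\<Prod>b\<in>Basis. (u - l) \<bullet> b)"
    unfolding prod_Basis_cart
    by (simp add: to_copy_def) (rule arg_cong[where f=ennreal], rule prod.reindex_bij_betw[OF bij_orig])
  finally show "emeasure (distr lborel borel of_copy) (box l u) = (\<Prod>b\<in>Basis. (u - l) \<bullet> b)" .
qed simp

lemma of_copy_vimage_borel:
  fixes S :: "(real^'n) set"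
  assumes "S \<in> sets borel"
  shows "of_copy -` S \<in> sets borel" "emeasure lborel (of_copy -` S) = emeasure lborel S"
proof -
  have meas: "(of_copy :: _ \<Rightarrow> real^'n) \<in> borel_measurable borel"
    by (rule borel_measurable_continuous_onI[OF linear_continuous_on[OF bounded_linear_of_copy]])
  show "of_copy -` S \<in> sets borel"
    using measurable_sets[OF meas assms] by simp
  show "emeasure lborel (of_copy -` S) = emeasure lborel S"
    using emeasure_distr[of "of_copy :: _ \<Rightarrow> real^'n" lborel borel S] assms meas
    unfolding distr_of_copy by simp
qed

text \<open>Conjugating \<open>g\<close> with the relabelling permutes rows and columns of the
  Jacobian matrix simultaneously; the entry bound, the dimension and the measures of
  \<open>S\<close> and \<open>T\<close> are preserved.\<close>

lemma emeasure_le_of_differentiable_cover: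
  fixes g :: "real^'n \<Rightarrow> real^'n" and A :: "real^'n \<Rightarrow> real^'n^'n"
  assumes S: "S \<in> sets borel" "bounded S" and A: "continuous_on S A"
    and g: "\<And>x. x \<in> S \<Longrightarrow> (g has_derivative (\<lambda>v. A x *v v)) (at x)"
    and B: "\<And>x i j. x \<in> S \<Longrightarrow> \<bar>A x$i$j\<bar> \<le> B" and T: "T \<in> sets borel" "T \<subseteq> g ` S"
  shows "emeasure lborel T \<le> ennreal (fact CARD('n) * B ^ CARD('n)) * emeasure lborel S"
proof -
  define S' where "S' = of_copy -` S"
  define T' where "T' = of_copy -` T"
  define A' where "A' y = (\<chi> i j. A (of_copy y) $ orig i $ orig j)" for y
  define g' where "g' y = to_copy (g (of_copy y))" for y
  have "S' = to_copy ` S"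
    by (auto simp: S'_def image_iff) (metis to_of_copy)
  then have bdd: "bounded S'"
    using bounded_linear_image[OF S(2) bounded_linear_to_copy] by simp
  have "continuous_on S' (\<lambda>y. A (of_copy y))"
    by (rule continuous_on_compose2[OF A linear_continuous_on[OF bounded_linear_of_copy]])
       (auto simp: S'_def)
  then have A': "continuous_on S' A'"
    unfolding A'_def by (auto intro!: continuous_intros)
  have der: "(g' has_derivative (\<lambda>v. A' y *v v)) (at y)" if "y \<in> S'" for y
  proof -
    have "((\<lambda>y. g (of_copy y)) has_derivative (\<lambda>v. A (of_copy y) *v of_copy v)) (at y)"
      using that
      by (intro has_derivative_compose[OF bounded_linear_imp_has_derivative[OF bounded_linear_of_copy] g])
         (simp add: S'_def)
    then have "(g' has_derivative (\<lambda>v. to_copy (A (of_copy y) *v of_copy v))) (at y)"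
      unfolding g'_def by (rule bounded_linear.has_derivative[OF bounded_linear_to_copy])
    moreover have "to_copy (A (of_copy y) *v of_copy v) = A' y *v v" for v
    proof -
      have "(\<Sum>j\<in>UNIV. A (of_copy y) $ orig i $ j * v $ Ordered_Copy j)
          = (\<Sum>j\<in>UNIV. A (of_copy y) $ orig i $ orig j * v $ j)" for i
        using sum.reindex_bij_betw[OF bij_orig,
            of "\<lambda>j. A (of_copy y) $ orig i $ j * v $ Ordered_Copy j"] by simp
      then show ?thesis
        by (simp add: to_copy_def of_copy_def A'_def matrix_vector_mult_def vec_eq_iff)
    qed
    ultimately show ?thesis by simp
  qed
  have "T' \<subseteq> g' ` S'"
  proof
    fix y assume "y \<in> T'"
    then obtain s where s: "s \<in> S" "of_copy y = g s" using T(2) by (auto simp: T'_def)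
    then have "y = g' (to_copy s)" by (metis g'_def of_to_copy to_of_copy)
    then show "y \<in> g' ` S'" using s by (auto simp: S'_def)
  qed
  moreover have "\<bar>A' y$i$j\<bar> \<le> B" if "y \<in> S'" for y i j
    using B that by (simp add: A'_def S'_def)
  ultimately have "emeasure lborel T' \<le> ennreal (fact CARD('n ordered_copy) * B ^ CARD('n ordered_copy)) * emeasure lborel S'"
    using of_copy_vimage_borel(1) S(1) T(1) bdd A' der
    by (intro emeasure_le_of_differentiable_cover_wellorder[where g=g' and A=A']) (auto simp: S'_def T'_def)
  then show ?thesis
    unfolding S'_def T'_def card_ordered_copy
      of_copy_vimage_borel(2)[OF S(1)] of_copy_vimage_borel(2)[OF T(1)] .
qed


section \<open>The Alexandrov--Bakelman--Pucci estimate\<close>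

text \<open>A paraboloid of opening \<kappa> and slope \<open>p\<close> at \<open>x0\<close> touches
  \<open>f\<close> from above at the maximum of \<open>\<phi>\<close> over \<open>Z\<close>. The
  linear term changes \<open>\<phi>\<close> by less than \<open>h / 2\<close> and the quadratic term
  equals \<open>h / 2\<close> at distance \<open>r\<close>, so neither part of the rim can carry the
  maximum.\<close>

lemma abp_contact_point:
  fixes f :: "'a::euclidean_space \<Rightarrow> real" and G :: "'a \<Rightarrow> 'a" and H :: "'a \<Rightarrow> 'a \<Rightarrow> 'a"
  assumes "open \<Omega>" "\<Omega> \<subseteq> Z" "compact Z" "continuous_on Z f" "Z \<subseteq> cball x0 r" "x0 \<in> Z"
    and max: "\<And>x. x \<in> Z \<Longrightarrow> f x \<le> f x0"
    and rim: "\<And>x. x \<in> Z - \<Omega> \<Longrightarrow> f x \<le> f x0 - h \<or> r \<le> dist x0 x"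
    and f: "\<And>x. x \<in> \<Omega> \<Longrightarrow> (f has_derivative (\<lambda>v. G x \<bullet> v)) (at x)"
    and G: "\<And>x. x \<in> \<Omega> \<Longrightarrow> (G has_derivative H x) (at x)"
    and "0 < h" "0 < r" and p: "norm p < h / (2 * r)"
  shows "\<exists>x\<in>\<Omega>. dist x0 x < r \<and> G x = p + (h / r\<^sup>2) *\<^sub>R (x - x0) \<and>
    (\<forall>v. 0 \<le> (h / r\<^sup>2) * (v \<bullet> v) - H x v \<bullet> v)"
proof -
  define \<kappa> where "\<kappa> = h / r\<^sup>2"
  have \<kappa>: "\<kappa> > 0" "\<kappa> * r\<^sup>2 = h" using \<open>0 < h\<close> \<open>0 < r\<close> by (auto simp: \<kappa>_def)
  have pr: "norm p * r < h / 2" using p \<open>0 < r\<close> by (simp add: field_simps)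
  define \<phi> where "\<phi> x = f x - p \<bullet> (x - x0) - \<kappa> / 2 * ((x - x0) \<bullet> (x - x0))" for x
  have "continuous_on Z \<phi>"
    unfolding \<phi>_def by (intro continuous_intros assms)
  then obtain x where x: "x \<in> Z" and xmax: "\<And>y. y \<in> Z \<Longrightarrow> \<phi> y \<le> \<phi> x"
    using continuous_attains_sup[OF \<open>compact Z\<close>, of \<phi>] \<open>x0 \<in> Z\<close> by blast
  have low: "f x0 \<le> \<phi> x"
    using xmax[OF \<open>x0 \<in> Z\<close>] by (simp add: \<phi>_def)
  have dx: "norm (x - x0) \<le> r"
    using x \<open>Z \<subseteq> cball x0 r\<close> by (auto simp: dist_norm norm_minus_commute)
  have "- (p \<bullet> (x - x0)) \<le> norm p * norm (x - x0)"
    using Cauchy_Schwarz_ineq2[of p "x - x0"] by linarith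
  also have "\<dots> \<le> norm p * r" using dx by (intro mult_left_mono) auto
  finally have px: "- (p \<bullet> (x - x0)) < h / 2" using pr by linarith
  have sq: "0 \<le> \<kappa> / 2 * ((x - x0) \<bullet> (x - x0))" using \<kappa> by simp
  \<comment> \<open>This excludes the first alternative of \<open>rim\<close>: the value
    \<open>f x0\<close> of \<open>\<phi>\<close> at \<open>x0\<close> can be matched only if
    \<open>f\<close> has dropped by less than \<open>h\<close>.\<close>
  have gt: "f x0 - h < f x"
    using low px sq \<open>0 < h\<close> unfolding \<phi>_def by linarith
  \<comment> \<open>On the sphere the quadratic loss \<open>h / 2\<close> outweighs the possible
    linear gain, so \<open>\<phi> x\<close> would fall below \<open>f x \<le> f x0\<close>.\<close>
  have dlt: "norm (x - x0) < r"
  proof (rule ccontr)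
    assume "\<not> norm (x - x0) < r"
    with dx have "norm (x - x0) = r" by simp
    then have "\<kappa> / 2 * ((x - x0) \<bullet> (x - x0)) = h / 2"
      using \<kappa> by (simp add: power2_norm_eq_inner[symmetric])
    then show False using low px max[OF x] unfolding \<phi>_def by linarith
  qed
  have x\<Omega>: "x \<in> \<Omega>"
    using rim[of x] x gt dlt by (force simp: dist_norm norm_minus_commute)
  define G\<phi> where "G\<phi> y = G y - p - \<kappa> *\<^sub>R (y - x0)" for y
  have d\<phi>: "(\<phi> has_derivative (\<lambda>v. G\<phi> y \<bullet> v)) (at y)" if "y \<in> \<Omega>" for y
    unfolding \<phi>_def G\<phi>_def
    by (rule has_derivative_eq_rhs, (rule derivative_intros f that)+)
       (auto simp: algebra_simps inner_commute)
  have dG\<phi>: "(G\<phi> has_derivative (\<lambda>v. H x v - \<kappa> *\<^sub>R v)) (at x)"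
    unfolding G\<phi>_def
    by (rule has_derivative_eq_rhs, (rule derivative_intros G x\<Omega>)+) auto
  have mx: "\<phi> y \<le> \<phi> x" if "y \<in> \<Omega>" for y using xmax that \<open>\<Omega> \<subseteq> Z\<close> by auto
  have "(\<lambda>v. G\<phi> x \<bullet> v) = (\<lambda>v. 0)"
    using differential_zero_maxmin[OF x\<Omega> \<open>open \<Omega>\<close> d\<phi>[OF x\<Omega>]] mx by blast
  then have crit: "G\<phi> x = 0" by (metis inner_eq_zero_iff)
  have "(H x v - \<kappa> *\<^sub>R v) \<bullet> v \<le> 0" for v
    by (rule second_derivative_nonpos_at_max[OF \<open>open \<Omega>\<close> x\<Omega> d\<phi> dG\<phi> mx crit])
  then have "\<forall>v. 0 \<le> \<kappa> * (v \<bullet> v) - H x v \<bullet> v"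
    by (simp add: inner_diff_left)
  then show ?thesis
    using x\<Omega> dlt crit unfolding \<kappa>_def G\<phi>_def
    by (intro bexI[of _ x]) (auto simp: dist_norm norm_minus_commute algebra_simps)
qed

text \<open>The matrix \<open>a - \<theta> *\<^sub>R mat 1\<close> is positive semidefinite, so its
  trace pairing with \<open>N\<close> is nonnegative.\<close>

lemma elliptic_trace_bound:
  fixes a N :: "real^'n^'n"
  assumes a: "\<And>i j. a$i$j = a$j$i" "\<And>v. \<theta> * (v \<bullet> v) \<le> v \<bullet> (a *v v)"
    and N: "\<And>v. 0 \<le> v \<bullet> (N *v v)"
  shows "\<theta> * (\<Sum>k\<in>UNIV. N$k$k) \<le> (\<Sum>i\<in>UNIV. \<Sum>j\<in>UNIV. a$i$j * N$i$j)"
proof -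
  define P where "P = a - \<theta> *\<^sub>R mat 1"
  have "0 \<le> (\<Sum>i\<in>UNIV. \<Sum>j\<in>UNIV. P$i$j * N$i$j)"
  proof (rule trace_psd_mult_psd_nonneg[OF _ _ N])
    show "P$i$j = P$j$i" for i j using a(1)[of i j] by (simp add: P_def mat_def)
    show "0 \<le> v \<bullet> (P *v v)" for v
      using a(2)[of v]
      by (simp add: P_def matrix_vector_mult_diff_rdistrib inner_diff_right
          scaleR_matrix_vector_assoc[symmetric])
  qed
  also have "\<dots> = (\<Sum>i\<in>UNIV. \<Sum>j\<in>UNIV. a$i$j * N$i$j) - \<theta> * (\<Sum>i\<in>UNIV. \<Sum>j\<in>UNIV. mat 1$i$j * N$i$j)"
    by (simp add: P_def left_diff_distrib sum_subtractf sum_distrib_left mult.assoc)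
  also have "(\<Sum>i\<in>UNIV. \<Sum>j\<in>UNIV. mat 1$i$j * N$i$j) = (\<Sum>k\<in>UNIV. N$k$k)"
    by (intro sum.cong refl) (simp add: mat_def if_distrib[of "\<lambda>x. x * _"] cong: if_cong)
  finally show ?thesis by simp
qed

text \<open>At a contact point \<open>tr (a N)\<close> is at most \<open>abp_trace_const n C \<delta>\<close> times \<open>h / r\<^sup>2\<close>, where
  \<open>N = (h / r\<^sup>2) I - D\<^sup>2f\<close>: the contributions are \<open>n C\<close> from \<open>tr a\<close>, \<open>2 n C\<close> from the first-order
  term, and \<open>C / (1 - \<delta>)\<close> from \<open>lam f\<close>.\<close>

definition abp_trace_const :: "nat \<Rightarrow> real \<Rightarrow> real \<Rightarrow> real" where
  "abp_trace_const n C \<delta> = C * (3 * real n + 1 / (1 - \<delta>))"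

text \<open>Times r^n, this is the volume of a ball of radius \<kappa> r / 2 divided by the Jacobian
  bound n! (\<kappa> T / \<theta>)^n, where T is the trace constant; \<kappa> cancels, and with it
  the size of the function.\<close>

definition abp_const :: "nat \<Rightarrow> real \<Rightarrow> real \<Rightarrow> real \<Rightarrow> real" where
  "abp_const n \<theta> C \<delta> = unit_ball_vol (real n) / fact n * (\<theta> / (2 * abp_trace_const n C \<delta>)) ^ n"

lemma abp_trace_const_pos: "0 < n \<Longrightarrow> 0 < C \<Longrightarrow> \<delta> < 1 \<Longrightarrow> 0 < abp_trace_const n C \<delta>"
  unfolding abp_trace_const_def by (intro mult_pos_pos add_pos_pos) auto

lemma abp_const_pos: "0 < n \<Longrightarrow> 0 < \<theta> \<Longrightarrow> 0 < C \<Longrightarrow> \<delta> < 1 \<Longrightarrow> 0 < abp_const n \<theta> C \<delta>"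
  unfolding abp_const_def
  by (intro mult_pos_pos divide_pos_pos zero_less_power abp_trace_const_pos unit_ball_vol_pos) auto

text \<open>The map \<open>F\<close> sends the set \<open>E\<close> of points with controlled
  Jacobian onto a ball whose radius is proportional to \<kappa> r, while its Jacobian on
  \<open>E\<close> is of order \<kappa>^n. Comparing volumes gives the lower bound for
  \<open>E\<close>.\<close>

lemma abp_measure_estimate:
  fixes f :: "real^'n \<Rightarrow> real" and G b :: "real^'n \<Rightarrow> real^'n" and H a :: "real^'n \<Rightarrow> real^'n^'n"
  assumes \<Omega>: "open \<Omega>" "\<Omega> \<subseteq> Z" "compact Z" "continuous_on Z f" "Z \<subseteq> cball x0 r" "x0 \<in> Z"
    and max: "\<And>x. x \<in> Z \<Longrightarrow> f x \<le> f x0"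
    and rim: "\<And>x. x \<in> Z - \<Omega> \<Longrightarrow> f x \<le> \<delta> * f x0 \<or> r \<le> dist x0 x"
    and f: "\<And>x. x \<in> \<Omega> \<Longrightarrow> (f has_derivative (\<lambda>v. G x \<bullet> v)) (at x)"
    and G: "\<And>x. x \<in> \<Omega> \<Longrightarrow> (G has_derivative (\<lambda>v. H x *v v)) (at x)"
    and H: "continuous_on \<Omega> H"
    and a: "\<And>x i j. x \<in> \<Omega> \<Longrightarrow> a x$i$j = a x$j$i" "\<And>x i j. x \<in> \<Omega> \<Longrightarrow> \<bar>a x$i$j\<bar> \<le> C"
      "\<And>x v. x \<in> \<Omega> \<Longrightarrow> \<theta> * (v \<bullet> v) \<le> v \<bullet> (a x *v v)"
    and b: "\<And>x i. x \<in> \<Omega> \<Longrightarrow> \<bar>b x$i\<bar> \<le> C"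
    and pde: "\<And>x. x \<in> \<Omega> \<Longrightarrow>
      (\<Sum>i\<in>UNIV. \<Sum>j\<in>UNIV. a x$i$j * H x$i$j) + b x \<bullet> G x \<ge> - (lam * C * f x0)"
    and pos: "0 < f x0" "0 < \<theta>" "0 < C" "\<delta> < 1" "0 < r" "r \<le> 1" "0 \<le> lam" "lam * r\<^sup>2 \<le> 1"
  shows "\<exists>E\<in>sets borel. E \<subseteq> \<Omega> \<and> ennreal (abp_const CARD('n) \<theta> C \<delta> * r ^ CARD('n)) \<le> emeasure lborel E"
proof -
  let ?n = "CARD('n)"
  define h where "h = (1 - \<delta>) * f x0"
  define \<kappa> where "\<kappa> = h / r\<^sup>2"
  define T where "T = abp_trace_const ?n C \<delta>"
  define \<beta> where "\<beta> = \<kappa> * T / \<theta>"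
  define B where "B = fact ?n * \<beta> ^ ?n"
  have h: "h > 0" using pos by (simp add: h_def)
  have \<kappa>: "\<kappa> > 0" using h pos by (simp add: \<kappa>_def)
  have T: "T > 0" unfolding T_def using pos by (intro abp_trace_const_pos) auto
  have B: "B > 0" unfolding B_def \<beta>_def using \<kappa> T pos by simp
  define N where "N x = (\<chi> i j. \<kappa> * (if i = j then 1 else 0) - H x$i$j)" for x
  define F where "F x = \<kappa> *\<^sub>R (x - x0) - G x" for x
  \<comment> \<open>\<open>E\<close> replaces the contact set: it contains every contact point used
    below, and it is Borel because the entry bounds define a relatively closed subset of the open
    set \<open>\<Omega>\<close>.\<close>
  define E where "E = {x \<in> \<Omega>. \<forall>i j. \<bar>N x$i$j\<bar> \<le> \<beta>}"
  have N_mult: "N x *v v = \<kappa> *\<^sub>R v - H x *v v" for x v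
  proof -
    have "N x = \<kappa> *\<^sub>R mat 1 - H x" by (simp add: N_def vec_eq_iff mat_def)
    then show ?thesis
      by (simp add: matrix_vector_mult_diff_rdistrib scaleR_matrix_vector_assoc[symmetric])
  qed
  have F': "(F has_derivative (\<lambda>v. N x *v v)) (at x)" if "x \<in> \<Omega>" for x
    unfolding F_def N_mult
    by (rule has_derivative_eq_rhs, (rule derivative_intros G that)+) auto
  have N_cont: "continuous_on \<Omega> N"
    unfolding N_def by (auto intro!: continuous_intros H)
  have "open (\<Omega> \<inter> {x. \<beta> < \<bar>N x$i$j\<bar>})" for i j
  proof -
    have "continuous_on \<Omega> (\<lambda>x. \<bar>N x$i$j\<bar>)"
      by (intro continuous_intros N_cont)
    then have "open (\<Omega> \<inter> (\<lambda>x. \<bar>N x$i$j\<bar>) -` {\<beta><..})"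
      using \<open>open \<Omega>\<close> by (auto intro: continuous_open_preimage)
    then show ?thesis by (simp add: vimage_def)
  qed
  then have "open (\<Union>i j. \<Omega> \<inter> {x. \<beta> < \<bar>N x$i$j\<bar>})" by blast
  moreover have "E = \<Omega> - (\<Union>i j. \<Omega> \<inter> {x. \<beta> < \<bar>N x$i$j\<bar>})"
    unfolding E_def by (force simp: not_le[symmetric])
  ultimately have E_borel: "E \<in> sets borel"
    using \<open>open \<Omega>\<close> by auto
  have "bounded E"
    using \<Omega>(2,5) bounded_subset[OF bounded_cball[of x0 r], of E] by (auto simp: E_def)
  have cover: "ball 0 (h / (2 * r)) \<subseteq> F ` E"
  proof
    fix q :: "real^'n" assume "q \<in> ball 0 (h / (2 * r))"
    then have q: "norm (- q) < h / (2 * r)" by simp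
    have rim': "f x \<le> f x0 - h \<or> r \<le> dist x0 x" if "x \<in> Z - \<Omega>" for x
      using rim[OF that] by (simp add: h_def algebra_simps)
    \<comment> \<open>Slope \<open>- q\<close> is used because \<open>F\<close> is \<kappa> times
      the displacement minus the gradient: the contact condition then reads
      \<open>F x = q\<close>.\<close>
    obtain x where x: "x \<in> \<Omega>" "dist x0 x < r" and Gx: "G x = - q + \<kappa> *\<^sub>R (x - x0)"
      and psd: "\<And>v. 0 \<le> \<kappa> * (v \<bullet> v) - (H x *v v) \<bullet> v"
      using abp_contact_point[OF \<Omega> max rim' f G h \<open>0 < r\<close> q] unfolding \<kappa>_def by blast
    have Fx: "F x = q" by (simp add: F_def Gx)
    have N_psd: "0 \<le> v \<bullet> (N x *v v)" for v
      using psd[of v] by (simp add: N_mult inner_diff_right inner_commute)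
    have "(H x *v axis i 1) \<bullet> axis j 1 = (H x *v axis j 1) \<bullet> axis i 1" for i j
      by (rule second_derivative_symmetric[OF \<open>open \<Omega>\<close> x(1) f G[OF x(1)]])
    then have H_sym: "H x$i$j = H x$j$i" for i j
      by (simp add: matrix_vector_mult_basis column_def inner_axis)
    have N_sym: "N x$i$j = N x$j$i" for i j by (simp add: N_def H_sym[of i j])
    have "norm (G x) \<le> norm (- q) + norm (\<kappa> *\<^sub>R (x - x0))"
      unfolding Gx by (rule norm_triangle_ineq)
    also have "norm (\<kappa> *\<^sub>R (x - x0)) \<le> \<kappa> * r"
      using x \<kappa> by (simp add: dist_norm norm_minus_commute)
    also have "\<kappa> * r = h / r" using pos by (simp add: \<kappa>_def power2_eq_square)
    also have "norm (- q) + h / r \<le> 2 * (h / r)"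
    proof -
      define s where "s = h / r"
      have "norm (- q) < s / 2" using q by (simp add: s_def mult.commute)
      moreover have "0 < s" using h pos by (simp add: s_def)
      ultimately show ?thesis unfolding s_def[symmetric] by linarith
    qed
    \<comment> \<open>Here \<open>r \<le> 1\<close> enters; it makes the first-order term of the
      equation as small as the second-order one.\<close>
    also have "h / r \<le> \<kappa>"
      unfolding \<kappa>_def using h pos
      by (intro divide_left_mono) (auto simp: power2_eq_square mult_le_one)
    finally have nG: "norm (G x) \<le> 2 * \<kappa>" by simp
    have "b x \<bullet> G x \<le> (\<Sum>i\<in>(UNIV::'n set). C * (2 * \<kappa>))"
      unfolding inner_vec_def
    proof (rule sum_mono)
      fix i
      have "b x$i \<bullet> G x$i \<le> \<bar>b x$i\<bar> * \<bar>G x$i\<bar>"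
        by (metis abs_ge_self abs_mult inner_real_def)
      also have "\<dots> \<le> C * (2 * \<kappa>)"
        using b[OF x(1), of i] component_le_norm_cart[of "G x" i] nG pos
        by (intro mult_mono) auto
      finally show "b x$i \<bullet> G x$i \<le> C * (2 * \<kappa>)" .
    qed
    then have bG: "b x \<bullet> G x \<le> ?n * (C * (2 * \<kappa>))" by simp
    \<comment> \<open>The scale condition \<open>lam * r\<^sup>2 \<le> 1\<close> makes the
      zeroth-order term comparable to \<kappa>, uniformly in \<open>lam\<close>.\<close>
    have "lam * f x0 \<le> \<kappa> / (1 - \<delta>)"
    proof -
      have "lam * f x0 * r\<^sup>2 \<le> f x0" using pos by (simp add: mult.commute mult.left_commute)
      then have "lam * f x0 \<le> f x0 / r\<^sup>2" using pos by (simp add: pos_le_divide_eq)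
      also have "f x0 / r\<^sup>2 = \<kappa> / (1 - \<delta>)" using pos by (simp add: \<kappa>_def h_def)
      finally show ?thesis .
    qed
    from mult_left_mono[OF this, of C] have lamf: "lam * C * f x0 \<le> C * (\<kappa> / (1 - \<delta>))"
      using pos by (simp add: mult_ac)
    have "a x$i$j * N x$i$j = (if i = j then \<kappa> * a x$i$i else 0) - a x$i$j * H x$i$j" for i j
      by (simp add: N_def right_diff_distrib)
    \<comment> \<open>This is tr(aN) = \<kappa> tr(a) - tr(aH). The differential inequality bounds
      the last term, so all contributions are multiples of \<kappa> and add up to \<kappa>
      T.\<close>
    then have "(\<Sum>i\<in>UNIV. \<Sum>j\<in>UNIV. a x$i$j * N x$i$j)
        = (\<Sum>i\<in>UNIV. \<kappa> * a x$i$i) - (\<Sum>i\<in>UNIV. \<Sum>j\<in>UNIV. a x$i$j * H x$i$j)"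
      by (simp add: sum_subtractf)
    also have "(\<Sum>i\<in>UNIV. \<kappa> * a x$i$i) \<le> (\<Sum>i\<in>(UNIV::'n set). \<kappa> * C)"
      using a(2)[OF x(1)] \<kappa> by (intro sum_mono mult_left_mono) (auto intro: order_trans[OF abs_ge_self])
    also have "(\<Sum>i\<in>(UNIV::'n set). \<kappa> * C) = ?n * (\<kappa> * C)" by simp
    finally have "(\<Sum>i\<in>UNIV. \<Sum>j\<in>UNIV. a x$i$j * N x$i$j)
        \<le> ?n * (\<kappa> * C) + C * (\<kappa> / (1 - \<delta>)) + ?n * (C * (2 * \<kappa>))"
      using pde[OF x(1)] bG lamf by linarith
    also have "\<dots> = \<kappa> * T" by (simp add: T_def abp_trace_const_def algebra_simps)
    finally have "\<theta> * (\<Sum>k\<in>UNIV. N x$k$k) \<le> \<kappa> * T"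
      using elliptic_trace_bound[OF a(1)[OF x(1)] a(3)[OF x(1)] N_psd] by linarith
    then have "(\<Sum>k\<in>UNIV. N x$k$k) \<le> \<kappa> * T / \<theta>"
      using pos by (simp add: pos_le_divide_eq mult.commute)
    then have "\<bar>N x$i$j\<bar> \<le> \<beta>" for i j
      using psd_entry_le_trace[OF N_sym N_psd, of i j] unfolding \<beta>_def by linarith
    then show "q \<in> F ` E" using x Fx by (force simp: E_def)
  qed
  let ?u = "unit_ball_vol (real ?n) * (h / (2 * r)) ^ ?n"
  have u0: "?u \<ge> 0" using h pos by simp
  have "ennreal ?u = emeasure lborel (ball (0::real^'n) (h / (2 * r)))"
    using h pos by (simp add: emeasure_ball)
  also have "\<dots> \<le> ennreal B * emeasure lborel E"
    unfolding B_def
    by (rule emeasure_le_of_differentiable_cover[OF E_borel \<open>bounded E\<close> _ F' _ _ cover])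
       (use continuous_on_subset[OF N_cont] in \<open>auto simp: E_def\<close>)
  finally have "ennreal ?u \<le> ennreal B * emeasure lborel E" .
  from divide_right_mono_ennreal[OF this, of "ennreal B"]
  have le: "ennreal (?u / B) \<le> emeasure lborel E"
    using B u0 by (simp add: divide_ennreal ennreal_mult_divide_eq mult.commute[of "ennreal B"])
  have id: "unit_ball_vol (real ?n) * (h / (2 * r)) ^ ?n / B = abp_const ?n \<theta> C \<delta> * r ^ ?n"
  proof -
    have "h / (2 * r) / (\<kappa> * T / \<theta>) = \<theta> / (2 * T) * r"
      using h pos T by (simp add: \<kappa>_def power2_eq_square)
    then have "(h / (2 * r)) ^ ?n / (\<kappa> * T / \<theta>) ^ ?n = (\<theta> / (2 * T)) ^ ?n * r ^ ?n"
      by (metis power_divide power_mult_distrib)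
    moreover have "?u / B = unit_ball_vol (real ?n) / fact ?n * ((h / (2 * r)) ^ ?n / (\<kappa> * T / \<theta>) ^ ?n)"
      unfolding B_def \<beta>_def by (rule times_divide_times_eq[symmetric])
    ultimately show ?thesis
      unfolding abp_const_def T_def[symmetric] by (simp only: mult.assoc)
  qed
  show ?thesis using E_borel le[unfolded id] by (intro bexI[of _ E]) (auto simp: E_def)
qed


section \<open>The Laplace--Beltrami operator in a chart\<close>

definition has_C1_gradient :: "(real^'n \<Rightarrow> real) \<Rightarrow> (real^'n \<Rightarrow> real^'n) \<Rightarrow> (real^'n) set \<Rightarrow> bool" where
  "has_C1_gradient f G S \<longleftrightarrow>
    continuous_on S G \<and> (\<forall>x\<in>S. (f has_derivative (\<lambda>v. G x \<bullet> v)) (at x))"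

text \<open>Closure of this class under algebra, square roots and matrix inversion makes the
  coefficients of the operator continuously differentiable; the gradients obtained from it are then
  bounded on compact sets.\<close>

definition C1_on :: "(real^'n) set \<Rightarrow> (real^'n \<Rightarrow> real) \<Rightarrow> bool" where
  "C1_on S f \<longleftrightarrow> (\<exists>G. has_C1_gradient f G S)"

lemma C1_on_imp_continuous_on: "C1_on S f \<Longrightarrow> continuous_on S f"
  unfolding C1_on_def has_C1_gradient_def
  by (metis continuous_at_imp_continuous_on has_derivative_continuous)

lemma C1_on_subset: "C1_on S f \<Longrightarrow> T \<subseteq> S \<Longrightarrow> C1_on T f"
  unfolding C1_on_def has_C1_gradient_def by (meson continuous_on_subset subsetD)

lemma C1_on_const:
  fixes S :: "(real^'n) set"
  shows "C1_on S (\<lambda>x. c)"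
proof -
  have "(\<lambda>v::real^'n. 0 \<bullet> v) = (\<lambda>v. 0)" by simp
  then have "has_C1_gradient (\<lambda>x. c) (\<lambda>_. 0) S"
    unfolding has_C1_gradient_def by (metis continuous_on_const has_derivative_const)
  then show ?thesis unfolding C1_on_def by blast
qed

lemma C1_on_cong:
  assumes "C1_on S f" "open S" "\<And>x. x \<in> S \<Longrightarrow> f x = g x" shows "C1_on S g"
proof -
  obtain G where G: "has_C1_gradient f G S" using assms(1) unfolding C1_on_def by blast
  have "(g has_derivative (\<lambda>v. G x \<bullet> v)) (at x)" if "x \<in> S" for x
    by (rule has_derivative_transform_within_open[of f _ x UNIV S g])
       (use G assms(2,3) that in \<open>auto simp: has_C1_gradient_def\<close>)
  then show ?thesis using G unfolding C1_on_def has_C1_gradient_def by blast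
qed

lemma C1_on_add:
  assumes "C1_on S f" "C1_on S g" shows "C1_on S (\<lambda>x. f x + g x)"
proof -
  obtain F G where "has_C1_gradient f F S" "has_C1_gradient g G S"
    using assms unfolding C1_on_def by blast
  then have "has_C1_gradient (\<lambda>x. f x + g x) (\<lambda>x. F x + G x) S"
    unfolding has_C1_gradient_def
    by (auto intro!: continuous_intros derivative_eq_intros simp: inner_add_left)
  then show ?thesis unfolding C1_on_def by blast
qed

lemma C1_on_mult:
  assumes "C1_on S f" "C1_on S g" shows "C1_on S (\<lambda>x. f x * g x)"
proof -
  obtain F G where FG: "has_C1_gradient f F S" "has_C1_gradient g G S"
    using assms unfolding C1_on_def by blast
  have "has_C1_gradient (\<lambda>x. f x * g x) (\<lambda>x. f x *\<^sub>R G x + g x *\<^sub>R F x) S"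
    unfolding has_C1_gradient_def
  proof (intro conjI ballI)
    show "continuous_on S (\<lambda>x. f x *\<^sub>R G x + g x *\<^sub>R F x)"
      using FG assms[THEN C1_on_imp_continuous_on]
      unfolding has_C1_gradient_def by (intro continuous_intros) auto
    fix x assume x: "x \<in> S"
    have "((\<lambda>x. f x * g x) has_derivative (\<lambda>v. f x * (G x \<bullet> v) + (F x \<bullet> v) * g x)) (at x)"
      using FG x unfolding has_C1_gradient_def by (intro has_derivative_mult) auto
    then show "((\<lambda>x. f x * g x) has_derivative (\<lambda>v. (f x *\<^sub>R G x + g x *\<^sub>R F x) \<bullet> v)) (at x)"
      by (simp add: inner_add_left mult.commute)
  qed
  then show ?thesis unfolding C1_on_def by blast
qed

lemma C1_on_compose_real:
  assumes "C1_on S f" and \<phi>: "\<And>x. x \<in> S \<Longrightarrow> (\<phi> has_real_derivative \<phi>' (f x)) (at (f x))"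
    and \<phi>': "continuous_on (f ` S) \<phi>'"
  shows "C1_on S (\<lambda>x. \<phi> (f x))"
proof -
  obtain F where F: "has_C1_gradient f F S"
    using assms unfolding C1_on_def by blast
  have "has_C1_gradient (\<lambda>x. \<phi> (f x)) (\<lambda>x. \<phi>' (f x) *\<^sub>R F x) S"
    unfolding has_C1_gradient_def
  proof (intro conjI ballI)
    have "continuous_on S (\<lambda>x. \<phi>' (f x))"
      by (rule continuous_on_compose2[OF \<phi>' C1_on_imp_continuous_on[OF assms(1)]]) auto
    then show "continuous_on S (\<lambda>x. \<phi>' (f x) *\<^sub>R F x)"
      using F unfolding has_C1_gradient_def by (intro continuous_intros) auto
    fix x assume x: "x \<in> S"
    have "((\<lambda>x. \<phi> (f x)) has_derivative (\<lambda>v. \<phi>' (f x) * (F x \<bullet> v))) (at x)"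
      by (rule has_derivative_compose[where g=\<phi>])
         (use F \<phi>[OF x] x in \<open>auto simp: has_C1_gradient_def has_field_derivative_def\<close>)
    then show "((\<lambda>x. \<phi> (f x)) has_derivative (\<lambda>v. (\<phi>' (f x) *\<^sub>R F x) \<bullet> v)) (at x)"
      by simp
  qed
  then show ?thesis unfolding C1_on_def by blast
qed

lemma C1_on_inverse:
  assumes "C1_on S f" "\<And>x. x \<in> S \<Longrightarrow> f x \<noteq> 0" shows "C1_on S (\<lambda>x. inverse (f x))"
proof (rule C1_on_compose_real[OF assms(1), where \<phi>'="\<lambda>y. - (inverse y ^ Suc (Suc 0))"])
  show "(inverse has_real_derivative - (inverse (f x) ^ Suc (Suc 0))) (at (f x))" if "x \<in> S" for x
    using assms(2)[OF that] by (rule DERIV_inverse)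
  have "y \<noteq> 0" if "y \<in> f ` S" for y using assms(2) that by auto
  then show "continuous_on (f ` S) (\<lambda>y. - (inverse y ^ Suc (Suc 0)))"
    by (intro continuous_intros) auto
qed

lemma C1_on_sqrt:
  assumes "C1_on S f" "\<And>x. x \<in> S \<Longrightarrow> 0 < f x" shows "C1_on S (\<lambda>x. sqrt (f x))"
proof (rule C1_on_compose_real[OF assms(1), where \<phi>'="\<lambda>y. inverse (sqrt y) / 2"])
  show "(sqrt has_real_derivative inverse (sqrt (f x)) / 2) (at (f x))" if "x \<in> S" for x
    using assms(2)[OF that] by (rule DERIV_real_sqrt)
  have "sqrt y \<noteq> 0" if "y \<in> f ` S" for y using assms(2) that by force
  then show "continuous_on (f ` S) (\<lambda>y. inverse (sqrt y) / 2)"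
    by (intro continuous_intros) auto
qed

lemma C1_on_sum:
  assumes "\<And>i. i \<in> I \<Longrightarrow> C1_on S (f i)" shows "C1_on S (\<lambda>x. \<Sum>i\<in>I. f i x)"
  using assms by (induction I rule: infinite_finite_induct) (auto intro: C1_on_const C1_on_add)

lemma C1_on_prod:
  assumes "\<And>i. i \<in> I \<Longrightarrow> C1_on S (f i)" shows "C1_on S (\<lambda>x. \<Prod>i\<in>I. f i x)"
  using assms by (induction I rule: infinite_finite_induct) (auto intro: C1_on_const C1_on_mult)

lemma C1_on_det:
  fixes A :: "real^'n \<Rightarrow> real^'m^'m"
  assumes "\<And>i j. C1_on S (\<lambda>x. A x$i$j)" shows "C1_on S (\<lambda>x. det (A x))"
  unfolding det_def by (intro C1_on_sum C1_on_mult C1_on_const C1_on_prod assms)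

lemma matrix_inv_right:
  fixes A :: "real^'n^'n"
  assumes "det A \<noteq> 0" shows "A ** matrix_inv A = mat 1"
proof -
  have "\<exists>B. A ** B = mat 1 \<and> B ** A = mat 1"
    using assms invertible_det_nz[of A] by (simp add: invertible_def)
  then show ?thesis unfolding matrix_inv_def by (rule someI2_ex) simp
qed

text \<open>Cramer's rule for the \<open>j\<close>-th column of the inverse. It exhibits the entry
  as a polynomial in the entries of \<open>A\<close> over \<open>det A\<close>, hence as a
  continuously differentiable function of them.\<close>

lemma matrix_inv_entry:
  fixes A :: "real^'n^'n"
  assumes "det A \<noteq> 0"
  shows "matrix_inv A$i$j = det (\<chi> k l. if l = i then axis j 1$k else A$k$l) * inverse (det A)"
proof -
  have "A *v (matrix_inv A *v axis j 1) = axis j 1"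
    by (simp add: matrix_vector_mul_assoc matrix_inv_right[OF assms])
  then have "matrix_inv A *v axis j 1 = (\<chi> i. det (\<chi> k l. if l = i then axis j 1$k else A$k$l) / det A)"
    using cramer[OF assms] by simp
  then have "(matrix_inv A *v axis j 1)$i = det (\<chi> k l. if l = i then axis j 1$k else A$k$l) / det A"
    by simp
  then show ?thesis
    by (simp add: matrix_vector_mult_basis column_def divide_inverse)
qed

lemma C1_on_matrix_inv:
  fixes A :: "real^'n \<Rightarrow> real^'m^'m"
  assumes "open S" and A: "\<And>i j. C1_on S (\<lambda>x. A x$i$j)" and nz: "\<And>x. x \<in> S \<Longrightarrow> det (A x) \<noteq> 0"
  shows "C1_on S (\<lambda>x. matrix_inv (A x)$i$j)"
proof -
  have "C1_on S (\<lambda>x. (\<chi> k l. if l = i then axis j 1$k else A x$k$l)$p$q)" for p q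
    by (cases "q = i") (auto intro: C1_on_const A)
  then have "C1_on S (\<lambda>x. det (\<chi> k l. if l = i then axis j 1$k else A x$k$l) * inverse (det (A x)))"
    by (intro C1_on_mult C1_on_inverse C1_on_det A nz)
  then show ?thesis
    by (rule C1_on_cong[OF _ \<open>open S\<close>]) (rule matrix_inv_entry[OF nz, symmetric])
qed

section \<open>Gradients and Hessians from partial derivatives\<close>

lemma Ck_on_Suc_imp_has_gradient:
  fixes f :: "real^'n \<Rightarrow> real"
  assumes "open S" "Ck_on (Suc m) S f" "x \<in> S"
  shows "(f has_derivative (\<lambda>v. (\<chi> i. partial_deriv i f x) \<bullet> v)) (at x)"
proof -
  have d: "f differentiable (at x)"
    using assms differentiable_on_eq_differentiable_at[of S f] by simp
  then have lin: "linear (frechet_derivative f (at x))"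
    by (rule linear_frechet_derivative)
  have "frechet_derivative f (at x) v = (\<chi> i. partial_deriv i f x) \<bullet> v" for v
  proof -
    have "frechet_derivative f (at x) v = frechet_derivative f (at x) (\<Sum>i\<in>UNIV. v$i *\<^sub>R axis i 1)"
      using basis_expansion[of v] by (simp add: scalar_mult_eq_scaleR)
    also have "\<dots> = (\<Sum>i\<in>UNIV. v$i * partial_deriv i f x)"
      by (simp add: linear_sum[OF lin] linear_scale[OF lin] partial_deriv_def)
    finally show ?thesis by (simp add: inner_vec_def mult.commute)
  qed
  then have "frechet_derivative f (at x) = (\<lambda>v. (\<chi> i. partial_deriv i f x) \<bullet> v)" by blast
  then show ?thesis using frechet_derivative_works[THEN iffD1, OF d] by simp
qed


definition gradient :: "(real^'n \<Rightarrow> real) \<Rightarrow> real^'n \<Rightarrow> real^'n" where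
  "gradient f x = (\<chi> i. partial_deriv i f x)"

text \<open>Row \<open>i\<close> is the gradient of the \<open>i\<close>-th partial derivative, so
  this is the Jacobian matrix of \<open>gradient f\<close> without an appeal to symmetry.\<close>

definition hessian :: "(real^'n \<Rightarrow> real) \<Rightarrow> real^'n \<Rightarrow> real^'n^'n" where
  "hessian f x = (\<chi> i j. partial_deriv j (partial_deriv i f) x)"

lemma Ck_on_2_imp_has_gradient:
  assumes "open S" "Ck_on 2 S f" "x \<in> S"
  shows "(f has_derivative (\<lambda>v. gradient f x \<bullet> v)) (at x)"
  using Ck_on_Suc_imp_has_gradient[of S "Suc 0" f] assms
  by (simp add: gradient_def numeral_2_eq_2 del: Ck_on.simps)

lemma gradient_has_derivative_hessian:
  assumes "open S" "Ck_on 2 S f" "x \<in> S"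
  shows "(gradient f has_derivative (\<lambda>v. hessian f x *v v)) (at x)"
proof -
  have "(partial_deriv i f has_derivative (\<lambda>v. (hessian f x *v v)$i)) (at x)" for i
  proof -
    have "Ck_on (Suc 0) S (partial_deriv i f)"
      using assms by (simp add: numeral_2_eq_2)
    from Ck_on_Suc_imp_has_gradient[OF assms(1) this assms(3)] show ?thesis
      by (simp add: hessian_def matrix_vector_mult_def inner_vec_def)
  qed
  then have "((\<lambda>x. gradient f x \<bullet> b) has_derivative (\<lambda>v. (hessian f x *v v) \<bullet> b)) (at x)"
    if "b \<in> Basis" for b
    using that by (auto simp: Basis_vec_def inner_axis gradient_def)
  then show ?thesis
    by (simp add: has_derivative_componentwise_within[where f="gradient f"])
qed

lemma continuous_on_hessian:
  assumes "Ck_on 2 S f" shows "continuous_on S (hessian f)"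
  using assms unfolding hessian_def numeral_2_eq_2
  by (auto intro!: continuous_intros)

text \<open>The segment from the identity to \<open>A\<close> consists of matrices with positive
  form, hence of invertible ones, so the determinant cannot change sign along it.\<close>

lemma posdef_det_pos:
  fixes A :: "real^'n^'n"
  assumes "\<And>v. v \<noteq> 0 \<Longrightarrow> 0 < v \<bullet> (A *v v)"
  shows "0 < det A"
proof (rule ccontr)
  assume "\<not> 0 < det A"
  define P where "P t = (1 - t) *\<^sub>R mat 1 + t *\<^sub>R A" for t :: real
  have "continuous_on {0..1} (\<lambda>t. det (P t))"
    unfolding det_def P_def by (auto intro!: continuous_intros)
  moreover have "det (P 0) = 1" "det (P 1) = det A" by (auto simp: P_def)
  ultimately obtain t where t: "0 \<le> t" "t \<le> 1" "det (P t) = 0"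
    using IVT2'[of "\<lambda>t. det (P t)" 1 0 0] \<open>\<not> 0 < det A\<close> by auto
  then obtain v where v: "v \<noteq> 0" "P t *v v = 0"
    by (metis invertible_det_nz matrix_left_invertible_ker invertible_left_inverse)
  have "0 = v \<bullet> (P t *v v)" using v by simp
  also have "\<dots> = (1 - t) * (v \<bullet> v) + t * (v \<bullet> (A *v v))"
    by (simp add: P_def matrix_vector_mult_add_rdistrib scaleR_matrix_vector_assoc[symmetric] inner_add_right)
  also have "\<dots> > 0"
    using t assms[OF v(1)] v(1)
    by (cases "t = 1") (auto intro!: add_pos_nonneg mult_pos_pos)
  finally show False by simp
qed

text \<open>Symmetry comes from transposing \<open>A ** matrix_inv A = mat 1\<close>; for
  positivity, the form of the inverse at \<open>v\<close> equals the form of \<open>A\<close> at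
  \<open>w = matrix_inv A *v v\<close>.\<close>

lemma posdef_matrix_inv:
  fixes A :: "real^'n^'n"
  assumes sym: "transpose A = A" and pos: "\<And>v. v \<noteq> 0 \<Longrightarrow> 0 < v \<bullet> (A *v v)"
  shows "matrix_inv A$i$j = matrix_inv A$j$i" "v \<noteq> 0 \<Longrightarrow> 0 < v \<bullet> (matrix_inv A *v v)"
proof -
  have "det A \<noteq> 0" using posdef_det_pos[OF pos] by simp
  then have AB: "A ** matrix_inv A = mat 1" by (rule matrix_inv_right)
  have "transpose (matrix_inv A) ** A = transpose (A ** matrix_inv A)"
    unfolding matrix_transpose_mul sym ..
  then have "transpose (matrix_inv A) ** A = mat 1" by (simp only: AB transpose_mat)
  then have "matrix_inv A = (transpose (matrix_inv A) ** A) ** matrix_inv A" by simp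
  also have "\<dots> = transpose (matrix_inv A)"
    by (simp only: matrix_mul_assoc[symmetric] AB matrix_mul_rid)
  finally have "transpose (matrix_inv A) = matrix_inv A" by (rule HOL.sym)
  then have "matrix_inv A$i$j = transpose (matrix_inv A)$i$j" by simp
  then show "matrix_inv A$i$j = matrix_inv A$j$i" by (simp add: transpose_def)
  assume "v \<noteq> 0"
  define w where "w = matrix_inv A *v v"
  have "A *v w = v" by (simp add: w_def matrix_vector_mul_assoc AB)
  then have "w \<noteq> 0" using \<open>v \<noteq> 0\<close> by auto
  then show "0 < v \<bullet> (matrix_inv A *v v)"
    using pos[of w] \<open>A *v w = v\<close> by (simp add: w_def[symmetric] inner_commute)
qed

text \<open>With \<open>a = sqrt (det g) g\<^sup>-\<^sup>1\<close>, the operator is \<open>- (\<Sum>i j. \<partial>\<^sub>i (a\<^sub>i\<^sub>j \<partial>\<^sub>j f)) / sqrt (det g)\<close>.\<close>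

definition laplace_coeff :: "('a, 'n::finite) riem \<Rightarrow> ('a, 'n) chart \<Rightarrow> real^'n \<Rightarrow> real^'n^'n" where
  "laplace_coeff X c x = volume_density X c x *\<^sub>R matrix_inv (metric X c x)"

text \<open>The product rule turns the divergence form into the nondivergence form that the contact
  argument needs, with first-order coefficient b_j = \<Sum>_i \<partial>_i a_ij. Multiplying by the
  density clears the denominator.\<close>

lemma laplace_coord_expand:
  assumes S: "open S" "x \<in> S" and f: "Ck_on 2 S f"
    and a: "\<And>i j. ((\<lambda>y. laplace_coeff X c y$i$j) has_derivative (\<lambda>v. D i j \<bullet> v)) (at x)"
    and sym: "\<And>i j. laplace_coeff X c x$i$j = laplace_coeff X c x$j$i"
    and vol: "volume_density X c x \<noteq> 0"
  shows "- (laplace_coord X c f x * volume_density X c x) =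
    (\<Sum>i\<in>UNIV. \<Sum>j\<in>UNIV. laplace_coeff X c x$i$j * hessian f x$i$j) + (\<chi> j. \<Sum>i\<in>UNIV. D i j$i) \<bullet> gradient f x"
proof -
  let ?a = "laplace_coeff X c"
  have "partial_deriv i (\<lambda>y. volume_density X c y * grad_coord X c f y$i) x =
      (\<Sum>j\<in>UNIV. ?a x$i$j * hessian f x$j$i + D i j$i * gradient f x$j)" for i
  proof -
    have "(\<lambda>y. volume_density X c y * grad_coord X c f y$i) = (\<lambda>y. \<Sum>j\<in>UNIV. ?a y$i$j * gradient f y$j)"
      by (rule ext) (simp add: grad_coord_def laplace_coeff_def gradient_def matrix_vector_mult_def
          sum_distrib_left mult.assoc)
    moreover have "((\<lambda>y. \<Sum>j\<in>UNIV. ?a y$i$j * gradient f y$j) has_derivative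
        (\<lambda>v. \<Sum>j\<in>UNIV. ?a x$i$j * (hessian f x *v v)$j + (D i j \<bullet> v) * gradient f x$j)) (at x)"
      by (rule has_derivative_sum, rule has_derivative_mult, rule a,
          rule bounded_linear.has_derivative[OF bounded_linear_vec_nth],
          rule gradient_has_derivative_hessian[OF S(1) f S(2)])
    ultimately have "frechet_derivative (\<lambda>y. volume_density X c y * grad_coord X c f y$i) (at x) =
        (\<lambda>v. \<Sum>j\<in>UNIV. ?a x$i$j * (hessian f x *v v)$j + (D i j \<bullet> v) * gradient f x$j)"
      by (simp only: frechet_derivative_at[symmetric])
    then show ?thesis
      by (simp add: partial_deriv_def matrix_vector_mult_basis column_def inner_axis)
  qed
  then have "- (laplace_coord X c f x * volume_density X c x) =
      (\<Sum>i\<in>UNIV. \<Sum>j\<in>UNIV. ?a x$i$j * hessian f x$j$i) + (\<Sum>i\<in>UNIV. \<Sum>j\<in>UNIV. D i j$i * gradient f x$j)"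
    using vol by (simp add: laplace_coord_def div_coord_def sum.distrib)
  \<comment> \<open>The indices of the Hessian are exchanged through the symmetry of the coefficient
    matrix.\<close>
  also have "(\<Sum>i\<in>UNIV. \<Sum>j\<in>UNIV. ?a x$i$j * hessian f x$j$i)
      = (\<Sum>i\<in>UNIV. \<Sum>j\<in>UNIV. ?a x$i$j * hessian f x$i$j)"
    by (subst sum.swap) (simp add: sym)
  also have "(\<Sum>i\<in>UNIV. \<Sum>j\<in>UNIV. D i j$i * gradient f x$j) = (\<chi> j. \<Sum>i\<in>UNIV. D i j$i) \<bullet> gradient f x"
    by (subst sum.swap) (simp add: inner_vec_def sum_distrib_right)
  finally show ?thesis .
qed

lemma smooth_onE:
  assumes "smooth_on S f" "x \<in> S"
  obtains W F where "open W" "x \<in> W" "Ck_on m W F" "\<And>y. y \<in> W \<inter> S \<Longrightarrow> F y = f y"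
proof -
  have "\<exists>W F. open W \<and> x \<in> W \<and> (\<forall>m. Ck_on m W F) \<and> (\<forall>y\<in>W \<inter> S. F y = f y)"
    using assms by (simp add: smooth_on_def)
  then obtain W F where "open W" "x \<in> W" "\<forall>m. Ck_on m W F" "\<forall>y\<in>W \<inter> S. F y = f y"
    by (elim exE conjE)
  then show ?thesis by (intro that[of W F]) simp_all
qed

lemma smooth_on_imp_continuous_on:
  fixes f :: "real^'n \<Rightarrow> 'b::real_normed_vector"
  assumes "smooth_on S f" shows "continuous_on S f"
proof -
  have "continuous (at x within S) f" if "x \<in> S" for x
  proof -
    obtain W F where W: "open W" "x \<in> W" "Ck_on 0 W F" "\<And>y. y \<in> W \<inter> S \<Longrightarrow> F y = f y"
      using smooth_onE[where m=0, OF assms \<open>x \<in> S\<close>] by metis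
    have "isCont F x"
      using W(1-3) continuous_on_eq_continuous_at[of W F] by simp
    then have "(F \<longlongrightarrow> F x) (at x within S)"
      using continuous_at_imp_continuous_at_within continuous_within by blast
    moreover have "eventually (\<lambda>y. F y = f y) (at x within S)"
      unfolding eventually_at_topological using W by blast
    ultimately have "(f \<longlongrightarrow> F x) (at x within S)"
      by (rule Lim_transform_eventually)
    then show ?thesis
      using W(2,4) \<open>x \<in> S\<close> by (simp add: continuous_within)
  qed
  then show ?thesis by (simp add: continuous_on_eq_continuous_within)
qed

lemma C1_on_matrix_entry:
  fixes F :: "real^'n \<Rightarrow> real^'m^'m"
  assumes "open W" "Ck_on (Suc 0) W F" shows "C1_on W (\<lambda>x. F x$i$j)"
  unfolding C1_on_def has_C1_gradient_def
proof (intro exI conjI ballI)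
  let ?G = "\<lambda>x. \<chi> k. partial_deriv k F x$i$j"
  show "continuous_on W ?G" using assms(2) by (auto intro!: continuous_intros)
  fix x assume x: "x \<in> W"
  have d: "F differentiable (at x)"
    using assms x differentiable_on_eq_differentiable_at[of W F] by simp
  then have lin: "linear (frechet_derivative F (at x))" by (rule linear_frechet_derivative)
  have eq: "frechet_derivative F (at x) v$i$j = ?G x \<bullet> v" for v
  proof -
    have "frechet_derivative F (at x) v = frechet_derivative F (at x) (\<Sum>k\<in>UNIV. v$k *\<^sub>R axis k 1)"
      using basis_expansion[of v] by (simp add: scalar_mult_eq_scaleR)
    also have "\<dots> = (\<Sum>k\<in>UNIV. v$k *\<^sub>R partial_deriv k F x)"
      by (simp add: linear_sum[OF lin] linear_scale[OF lin] partial_deriv_def)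
    finally show ?thesis by (simp add: inner_vec_def mult.commute)
  qed
  have "((\<lambda>x. F x$i$j) has_derivative (\<lambda>v. frechet_derivative F (at x) v$i$j)) (at x)"
    using frechet_derivative_works[THEN iffD1, OF d]
    by (intro bounded_linear.has_derivative[OF bounded_linear_vec_nth])
  then show "((\<lambda>x. F x$i$j) has_derivative (\<lambda>v. ?G x \<bullet> v)) (at x)"
    unfolding eq .
qed

section \<open>Uniform ellipticity and coefficient bounds in a chart\<close>

lemma int_img_open:
  assumes "is_chart M (bdry_coord X) c" shows "open (int_img X c)"
proof -
  have "openin (top_of_set (half_space (bdry_coord X))) (chart_img c)"
    using assms by (simp add: is_chart_def)
  then obtain T where T: "open T" "chart_img c = half_space (bdry_coord X) \<inter> T"
    by (auto simp: openin_open)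
  have "int_img X c = T \<inter> {x. 0 < x $ bdry_coord X}"
    unfolding int_img_def T(2) half_space_def by auto
  then show ?thesis
    using open_Int[OF T(1) open_halfspace_component_gt_cart[of 0 "bdry_coord X"]] by simp
qed

text \<open>The constant is the minimum of the form over \<open>K\<close> times the unit sphere;
  homogeneity extends the inequality to all vectors.\<close>

lemma uniformly_elliptic_on_compact:
  fixes a :: "'a::metric_space \<Rightarrow> real^'n^'n"
  assumes "compact K" "continuous_on K a" and pos: "\<And>x v. x \<in> K \<Longrightarrow> v \<noteq> 0 \<Longrightarrow> 0 < v \<bullet> (a x *v v)"
  shows "\<exists>\<theta>>0. \<forall>x\<in>K. \<forall>v. \<theta> * (v \<bullet> v) \<le> v \<bullet> (a x *v v)"
proof (cases "K = {}")
  case True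
  then show ?thesis by (intro exI[of _ 1]) auto
next
  case False
  let ?S = "K \<times> sphere (0::real^'n) 1"
  let ?f = "\<lambda>p. snd p \<bullet> (a (fst p) *v snd p)"
  have "continuous_on ?S (\<lambda>p. a (fst p))"
    by (rule continuous_on_compose2[OF assms(2) continuous_on_fst]) auto
  then have "continuous_on ?S ?f"
    unfolding matrix_vector_mult_def by (intro continuous_intros)
  moreover have "compact ?S" using assms(1) by (intro compact_Times) auto
  moreover have "?S \<noteq> {}" using False by auto
  ultimately obtain p where p: "p \<in> ?S" "\<And>q. q \<in> ?S \<Longrightarrow> ?f p \<le> ?f q"
    using continuous_attains_inf[of ?S ?f] by blast
  show ?thesis
  proof (intro exI conjI ballI allI)
    have "snd p \<noteq> 0" using p(1) by auto
    then show "0 < ?f p" using p(1) pos by auto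
    fix x and v :: "real^'n" assume "x \<in> K"
    show "?f p * (v \<bullet> v) \<le> v \<bullet> (a x *v v)"
    proof (cases "v = 0")
      case False
      define w where "w = (1 / norm v) *\<^sub>R v"
      have w: "norm w = 1" "v = norm v *\<^sub>R w" using False by (auto simp: w_def)
      have "?f p \<le> w \<bullet> (a x *v w)"
        using p(2)[of "(x, w)"] \<open>x \<in> K\<close> w by simp
      then have "?f p * (norm v)\<^sup>2 \<le> (norm v)\<^sup>2 * (w \<bullet> (a x *v w))"
        by (subst mult.commute) (rule mult_left_mono, simp_all)
      also have "\<dots> = v \<bullet> (a x *v v)"
      proof -
        have "v \<bullet> (a x *v v) = (norm v *\<^sub>R w) \<bullet> (a x *v (norm v *\<^sub>R w))"
          by (simp only: w(2)[symmetric])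
        then show ?thesis by (simp add: matrix_vector_mult_scaleR power2_eq_square)
      qed
      finally show ?thesis by (simp add: power2_norm_eq_inner)
    qed simp
  qed
qed

text \<open>Near \<open>x0\<close>, possibly a boundary point, the metric extends smoothly to an
  open set, so density, coefficients and their derivatives are continuous on a compact half-ball.
  The quantifier order makes the first-order coefficient \<open>b\<close> depend on \<open>x\<close>
  but not on \<open>f\<close>.\<close>

lemma chart_pde_bounds:
  assumes X: "riemannian_manifold X" and c: "c \<in> atlas X" and x0: "x0 \<in> chart_img c"
  obtains \<rho> C \<theta> \<nu> where "\<rho> > 0" "C > 0" "\<theta> > 0" "\<nu> > 0"
    "half_space (bdry_coord X) \<inter> cball x0 \<rho> \<subseteq> chart_img c"
    "\<forall>x\<in>int_img X c \<inter> cball x0 \<rho>.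
      \<nu> \<le> volume_density X c x \<and> volume_density X c x \<le> C \<and>
      (\<forall>i j. laplace_coeff X c x$i$j = laplace_coeff X c x$j$i \<and> \<bar>laplace_coeff X c x$i$j\<bar> \<le> C) \<and>
      (\<forall>v. \<theta> * (v \<bullet> v) \<le> v \<bullet> (laplace_coeff X c x *v v)) \<and>
      (\<exists>b. (\<forall>i. \<bar>b$i\<bar> \<le> C) \<and> (\<forall>f. Ck_on 2 (int_img X c) f \<longrightarrow>
        - (laplace_coord X c f x * volume_density X c x) =
        (\<Sum>i\<in>UNIV. \<Sum>j\<in>UNIV. laplace_coeff X c x$i$j * hessian f x$i$j) + b \<bullet> gradient f x))"
proof -
  have chart: "is_chart (points X) (bdry_coord X) c"
    and smooth: "smooth_on (chart_img c) (metric X c)"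
    using X c by (simp_all add: riemannian_manifold_def smooth_manifold_def)
  have metric: "\<forall>x\<in>chart_img c. transpose (metric X c x) = metric X c x \<and>
      (\<forall>v. v \<noteq> 0 \<longrightarrow> 0 < v \<bullet> (metric X c x *v v))"
    using X c by (simp add: riemannian_manifold_def)
  have sym: "transpose (metric X c x) = metric X c x" if "x \<in> chart_img c" for x
    using metric that by simp
  have pos: "0 < v \<bullet> (metric X c x *v v)" if "x \<in> chart_img c" "v \<noteq> 0" for x v
    using metric that by simp
  obtain W F where W: "open W" "x0 \<in> W" "Ck_on (Suc 0) W F"
    and WF: "\<And>y. y \<in> W \<inter> chart_img c \<Longrightarrow> F y = metric X c y"
    using smooth_onE[where m="Suc 0", OF smooth x0] by metis
  \<comment> \<open>Outside the chart image the extension \<open>F\<close> need not be a metric; a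
    positive determinant is what keeps the square root and the inverse continuously
    differentiable.\<close>
  define W' where "W' = {x \<in> W. 0 < det (F x)}"
  have F1: "C1_on W (\<lambda>x. F x$i$j)" for i j by (rule C1_on_matrix_entry[OF W(1,3)])
  have "continuous_on W (\<lambda>x. det (F x))" by (intro C1_on_imp_continuous_on C1_on_det F1)
  then have W': "open W'"
    using continuous_open_preimage[OF _ W(1), of "\<lambda>x. det (F x)" "{0<..}"]
    by (simp add: W'_def vimage_def Collect_conj_eq)
  have F1': "C1_on W' (\<lambda>x. F x$i$j)" for i j
    by (rule C1_on_subset[OF F1]) (auto simp: W'_def)
  define V where "V x = sqrt (det (F x))" for x
  define a where "a x = V x *\<^sub>R matrix_inv (F x)" for x
  have V1: "C1_on W' V"
    unfolding V_def by (intro C1_on_sqrt C1_on_det F1') (auto simp: W'_def)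
  have a1: "C1_on W' (\<lambda>x. a x$i$j)" for i j
    unfolding a_def using C1_on_mult[OF V1 C1_on_matrix_inv[OF W' F1', of i j]] by (simp add: W'_def)
  then obtain D where D: "\<And>i j. has_C1_gradient (\<lambda>x. a x$i$j) (D i j) W'"
    unfolding C1_on_def by metis
  have metric_eq: "volume_density X c x = V x" "laplace_coeff X c x = a x" if "x \<in> W \<inter> chart_img c" for x
    using WF[OF that] by (auto simp: volume_density_def laplace_coeff_def V_def a_def)
  have inW': "x \<in> W'" if "x \<in> W \<inter> chart_img c" for x
    using that WF[OF that] posdef_det_pos[OF pos, of x] by (auto simp: W'_def)
  obtain T where T: "open T" "chart_img c = half_space (bdry_coord X) \<inter> T"
    using chart by (auto simp: is_chart_def openin_open)
  have "open (T \<inter> W)" "x0 \<in> T \<inter> W" using T W x0 by auto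
  then obtain \<rho> where \<rho>: "\<rho> > 0" "cball x0 \<rho> \<subseteq> T \<inter> W"
    using open_contains_cball by blast
  define K where "K = half_space (bdry_coord X) \<inter> cball x0 \<rho>"
  have "closed (half_space (bdry_coord X))"
    unfolding half_space_def by (intro closed_Collect_le continuous_intros)
  then have "compact K" unfolding K_def by (simp add: closed_Int_compact)
  have KW: "K \<subseteq> W \<inter> chart_img c" using \<rho> T by (auto simp: K_def)
  then have KW': "K \<subseteq> W'" using inW' by blast
  have "x0 \<in> K" using x0 T \<rho> by (auto simp: K_def)
  have cV: "continuous_on K V"
    using C1_on_imp_continuous_on[OF V1] KW' continuous_on_subset by blast
  have ca: "continuous_on K (\<lambda>x. a x$i$j)" for i j
    using C1_on_imp_continuous_on[OF a1] KW' continuous_on_subset by blast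
  have cD: "continuous_on K (D i j)" for i j
    using D KW' continuous_on_subset unfolding has_C1_gradient_def by blast
  obtain y where y: "y \<in> K" "\<And>x. x \<in> K \<Longrightarrow> V y \<le> V x"
    using continuous_attains_inf[OF \<open>compact K\<close> _ cV] \<open>x0 \<in> K\<close> by blast
  have Vpos: "0 < V x" if "x \<in> W'" for x using that by (simp add: V_def W'_def)
  \<comment> \<open>One function dominating the density, all coefficients and all their gradients,
    so that its maximum over \<open>K\<close> serves as the common constant
    \<open>C\<close>.\<close>
  define \<Phi> where "\<Phi> x = V x + (\<Sum>i\<in>UNIV. \<Sum>j\<in>UNIV. \<bar>a x$i$j\<bar>) + (\<Sum>i\<in>UNIV. \<Sum>j\<in>UNIV. norm (D i j x))" for x
  have "continuous_on K \<Phi>"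
    unfolding \<Phi>_def by (intro continuous_intros cV ca cD)
  then obtain z where z: "z \<in> K" "\<And>x. x \<in> K \<Longrightarrow> \<Phi> x \<le> \<Phi> z"
    using continuous_attains_sup[OF \<open>compact K\<close>, of \<Phi>] \<open>x0 \<in> K\<close> by blast
  have apos: "0 < v \<bullet> (a x *v v)" if "x \<in> K" "v \<noteq> 0" for x v
  proof -
    have "0 < v \<bullet> (matrix_inv (F x) *v v)"
      using posdef_matrix_inv(2)[OF sym pos \<open>v \<noteq> 0\<close>, of x] WF[of x] KW that by (metis subsetD IntD2)
    then show ?thesis
      using Vpos[of x] KW' that by (simp add: a_def scaleR_matrix_vector_assoc[symmetric] subset_iff)
  qed
  have "continuous_on K (\<lambda>x. \<chi> i j. a x$i$j)" by (intro continuous_intros ca)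
  then have cont_a: "continuous_on K a" by simp
  obtain \<theta> where \<theta>: "\<theta> > 0" "\<And>x v. x \<in> K \<Longrightarrow> \<theta> * (v \<bullet> v) \<le> v \<bullet> (a x *v v)"
    using uniformly_elliptic_on_compact[of K a, OF \<open>compact K\<close> cont_a apos] by metis
  have sums: "0 \<le> (\<Sum>i\<in>UNIV. \<Sum>j\<in>UNIV. \<bar>a x$i$j\<bar>)" "0 \<le> (\<Sum>i\<in>UNIV. \<Sum>j\<in>UNIV. norm (D i j x))" for x
    by (simp_all add: sum_nonneg)
  have main: "V y \<le> volume_density X c x \<and> volume_density X c x \<le> \<Phi> z \<and>
      (\<forall>i j. laplace_coeff X c x$i$j = laplace_coeff X c x$j$i \<and> \<bar>laplace_coeff X c x$i$j\<bar> \<le> \<Phi> z) \<and>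
      (\<forall>v. \<theta> * (v \<bullet> v) \<le> v \<bullet> (laplace_coeff X c x *v v)) \<and>
      (\<exists>b. (\<forall>i. \<bar>b$i\<bar> \<le> \<Phi> z) \<and> (\<forall>f. Ck_on 2 (int_img X c) f \<longrightarrow>
        - (laplace_coord X c f x * volume_density X c x) =
        (\<Sum>i\<in>UNIV. \<Sum>j\<in>UNIV. laplace_coeff X c x$i$j * hessian f x$i$j) + b \<bullet> gradient f x))"
    if x: "x \<in> int_img X c \<inter> cball x0 \<rho>" for x
  proof -
    have xK: "x \<in> K" using x T by (auto simp: int_img_def K_def)
    then have xW: "x \<in> W \<inter> chart_img c" and xW': "x \<in> W'" using KW KW' by auto
    note eq = metric_eq[OF xW]
    have V0: "0 < V x" by (rule Vpos[OF xW'])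
    have 1: "V y \<le> V x" by (rule y(2)[OF xK])
    have 2: "V x \<le> \<Phi> z" using z(2)[OF xK] sums[of x] unfolding \<Phi>_def by linarith
    have asym: "a x$i$j = a x$j$i" for i j
      using posdef_matrix_inv(1)[OF sym pos, of x i j] WF[OF xW] xW by (simp add: a_def)
    have 3: "\<bar>a x$i$j\<bar> \<le> \<Phi> z" for i j
    proof -
      have "\<bar>a x$i$j\<bar> \<le> (\<Sum>j\<in>UNIV. \<bar>a x$i$j\<bar>)" by (rule member_le_sum) auto
      also have "\<dots> \<le> (\<Sum>i\<in>UNIV. \<Sum>j\<in>UNIV. \<bar>a x$i$j\<bar>)"
        by (rule member_le_sum[where f="\<lambda>i. \<Sum>j\<in>UNIV. \<bar>a x$i$j\<bar>"]) (auto simp: sum_nonneg)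
      finally show ?thesis using z(2)[OF xK] sums[of x] V0 unfolding \<Phi>_def by linarith
    qed
    define b where "b = (\<chi> j. \<Sum>i\<in>UNIV. D i j x$i)"
    have 4: "\<bar>b$j\<bar> \<le> \<Phi> z" for j
    proof -
      have "\<bar>b$j\<bar> \<le> (\<Sum>i\<in>UNIV. \<bar>D i j x$i\<bar>)" by (simp add: b_def sum_abs)
      also have "\<dots> \<le> (\<Sum>i\<in>UNIV. norm (D i j x))" by (intro sum_mono component_le_norm_cart)
      also have "\<dots> \<le> (\<Sum>j\<in>UNIV. \<Sum>i\<in>UNIV. norm (D i j x))"
        by (rule member_le_sum[where f="\<lambda>j. \<Sum>i\<in>UNIV. norm (D i j x)"]) (auto simp: sum_nonneg)
      also have "\<dots> = (\<Sum>i\<in>UNIV. \<Sum>j\<in>UNIV. norm (D i j x))" by (rule sum.swap)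
      finally show ?thesis using z(2)[OF xK] sums[of x] V0 unfolding \<Phi>_def by linarith
    qed
    \<comment> \<open>\<open>laplace_coeff\<close> agrees with the coefficients of the extension on
      an open set around the interior point \<open>x\<close>, so the derivative carries
      over.\<close>
    have der: "((\<lambda>y. laplace_coeff X c y$i$j) has_derivative (\<lambda>v. D i j x \<bullet> v)) (at x)" for i j
    proof (rule has_derivative_transform_within_open[of "\<lambda>y. a y$i$j" _ x UNIV "int_img X c \<inter> W"])
      show "((\<lambda>y. a y$i$j) has_derivative (\<lambda>v. D i j x \<bullet> v)) (at x)"
        using D xW' unfolding has_C1_gradient_def by blast
      show "open (int_img X c \<inter> W)" using int_img_open[OF chart] W(1) by (rule open_Int)
      show "x \<in> int_img X c \<inter> W" using x xW by blast
      show "a y$i$j = laplace_coeff X c y$i$j" if "y \<in> int_img X c \<inter> W" for y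
        using metric_eq(2)[of y] that by (simp add: int_img_def)
    qed
    have pde: "- (laplace_coord X c f x * volume_density X c x) =
        (\<Sum>i\<in>UNIV. \<Sum>j\<in>UNIV. laplace_coeff X c x$i$j * hessian f x$i$j) + b \<bullet> gradient f x"
      if "Ck_on 2 (int_img X c) f" for f
      unfolding b_def
      by (rule laplace_coord_expand[OF int_img_open[OF chart] _ that der])
         (use x asym eq V0 in auto)
    show ?thesis
      using 1 2 3 4 asym \<theta>(2)[OF xK] pde unfolding eq by blast
  qed
  have \<Phi>z: "\<Phi> z > 0"
    using z(1) KW' Vpos[of z] sums[of z] unfolding \<Phi>_def by (simp add: subset_iff add_pos_nonneg)
  have Vy: "V y > 0" using y(1) KW' Vpos by blast
  have sub: "half_space (bdry_coord X) \<inter> cball x0 \<rho> \<subseteq> chart_img c" using KW K_def by blast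
  show ?thesis
    by (rule that[OF \<rho>(1) \<Phi>z \<theta>(1) Vy sub]) (rule ballI, rule main)
qed


section \<open>Nodal domains and Riemannian volume\<close>

lemma is_chart_param:
  assumes "is_chart M k c"
  shows "continuous_on (chart_img c) (param c)" "continuous_on (chart_dom c) (coord c)"
    "\<And>p. p \<in> chart_dom c \<Longrightarrow> param c (coord c p) = p"
    "\<And>p. p \<in> chart_dom c \<Longrightarrow> coord c p \<in> chart_img c"
    "\<And>x. x \<in> chart_img c \<Longrightarrow> param c x \<in> chart_dom c"
    "\<And>x. x \<in> chart_img c \<Longrightarrow> coord c (param c x) = x"
    "chart_dom c \<subseteq> M" "chart_img c \<subseteq> half_space k"
proof -
  have h: "homeomorphism (chart_dom c) (chart_img c) (coord c) (param c)"
    using assms by (simp add: is_chart_def)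
  show "continuous_on (chart_img c) (param c)" "continuous_on (chart_dom c) (coord c)"
    using h by (simp_all add: homeomorphism_def)
  show "param c (coord c p) = p" "coord c p \<in> chart_img c" if "p \<in> chart_dom c" for p
    using h that by (auto simp: homeomorphism_def)
  show "param c x \<in> chart_dom c" "coord c (param c x) = x" if "x \<in> chart_img c" for x
    using h that by (auto simp: homeomorphism_def)
  show "chart_dom c \<subseteq> M" "chart_img c \<subseteq> half_space k"
    using assms by (auto simp: is_chart_def dest: openin_imp_subset)
qed

text \<open>Local connectedness: a ball cut with the half-space is convex, hence connected, and the
  chart carries it to the manifold.\<close>

lemma connected_neighbourhood:
  fixes X :: "('a::t2_space, 'n::finite) riem"
  assumes X: "smooth_manifold X" and N: "openin (top_of_set (points X)) N" "p \<in> N"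
  obtains B where "connected B" "openin (top_of_set (points X)) B" "p \<in> B" "B \<subseteq> N"
proof -
  have "p \<in> points X" using N openin_imp_subset by blast
  then have "p \<in> (\<Union>c\<in>atlas X. chart_dom c)" using X by (simp add: smooth_manifold_def)
  then obtain c where c: "c \<in> atlas X" "p \<in> chart_dom c" by (rule UN_E)
  let ?H = "half_space (bdry_coord X)"
  have chart: "is_chart (points X) (bdry_coord X) c"
    using X c by (simp add: smooth_manifold_def)
  have dom: "openin (top_of_set (points X)) (chart_dom c)" and img: "openin (top_of_set ?H) (chart_img c)"
    and hom: "homeomorphism (chart_dom c) (chart_img c) (coord c) (param c)"
    using chart by (simp_all add: is_chart_def)
  have "openin (top_of_set (chart_dom c)) (chart_dom c \<inter> N)"
    using N(1) is_chart_param(7)[OF chart] by (metis openin_Int_open inf.orderE inf_commute openin_subtopology_Int2 subtopology_subtopology)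
  then have "openin (top_of_set (chart_img c)) (coord c ` (chart_dom c \<inter> N))"
    using homeomorphism_imp_open_map[OF hom] by blast
  then have "openin (top_of_set ?H) (coord c ` (chart_dom c \<inter> N))"
    using img openin_trans by blast
  moreover have "coord c p \<in> coord c ` (chart_dom c \<inter> N)" using c N by blast
  ultimately obtain e where e: "e > 0" "ball (coord c p) e \<inter> ?H \<subseteq> coord c ` (chart_dom c \<inter> N)"
    by (metis openin_contains_ball)
  define B0 where "B0 = ball (coord c p) e \<inter> ?H"
  have "B0 \<subseteq> chart_img c" using e(2) by (auto simp: B0_def chart_img_def)
  have "convex ?H"
    unfolding half_space_def using convex_halfspace_ge[of 0 "axis (bdry_coord X) 1 :: real^'n"]
    by (simp add: inner_axis')
  then have "connected B0"
    unfolding B0_def by (intro convex_connected convex_Int convex_ball)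
  then have conn: "connected (param c ` B0)"
    using connected_continuous_image continuous_on_subset[OF is_chart_param(1)[OF chart] \<open>B0 \<subseteq> chart_img c\<close>]
    by blast
  have "openin (top_of_set ?H) B0" unfolding B0_def by (metis inf_commute open_ball openin_open_Int)
  then have "openin (top_of_set (chart_img c)) B0"
    using \<open>B0 \<subseteq> chart_img c\<close> is_chart_param(8)[OF chart] openin_subset_trans by blast
  then have "openin (top_of_set (chart_dom c)) (param c ` B0)"
    using homeomorphism_imp_open_map[OF homeomorphism_symD[OF hom]] by blast
  then have op: "openin (top_of_set (points X)) (param c ` B0)"
    using dom openin_trans by blast
  have "coord c p \<in> B0"
    using e is_chart_param(4,8)[OF chart] c by (auto simp: B0_def)
  then have "p \<in> param c ` B0" using is_chart_param(3)[OF chart c(2)] by (metis image_eqI)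
  moreover have "param c ` B0 \<subseteq> N"
    using e(2) is_chart_param(3)[OF chart] by (force simp: B0_def)
  ultimately show ?thesis using that conn op by blast
qed

text \<open>A nodal domain is relatively closed in the nonzero set: a connected neighbourhood of
  \<open>p\<close> on which \<open>u\<close> does not vanish meets \<open>A\<close>, so maximality
  forces it into \<open>A\<close>.\<close>

lemma nodal_domain_closure:
  fixes X :: "('a::t2_space, 'n::finite) riem"
  assumes X: "smooth_manifold X" and u: "continuous_on (points X) u" and A: "nodal_domain X u A"
    and p: "p \<in> points X" "p \<in> closure A" "u p \<noteq> 0"
  shows "p \<in> A"
proof -
  have A': "A \<noteq> {}" "connected A" "openin (top_of_set (points X)) A" "A \<subseteq> {p \<in> points X. u p \<noteq> 0}"
    using A by (simp_all add: nodal_domain_def connected_open_in_nonzero_def)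
  have maximal: "B = A" if "connected_open_in_nonzero X u B" "A \<subseteq> B" for B
    using A that by (simp add: nodal_domain_def)
  have "openin (top_of_set (points X)) (points X \<inter> u -` (- {0}))"
    by (rule continuous_openin_preimage_gen[OF u open_Compl[OF closed_singleton]])
  then obtain B where B: "connected B" "openin (top_of_set (points X)) B" "p \<in> B"
      "B \<subseteq> points X \<inter> u -` (- {0})"
    using connected_neighbourhood[OF X, of "points X \<inter> u -` (- {0})" p] p by blast
  obtain T where T: "open T" "B = points X \<inter> T" using B(2) openin_open by metis
  have "A \<inter> T \<noteq> {}"
    using p(2) T B(3) unfolding closure_iff_nhds_not_empty by blast
  then have "A \<inter> B \<noteq> {}" using A'(4) T by blast
  then have "connected (A \<union> B)" using connected_Un A'(2) B(1) by blast
  then have "connected_open_in_nonzero X u (A \<union> B)"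
    unfolding connected_open_in_nonzero_def using A' B by (auto intro: openin_Un)
  then have "A \<union> B = A" by (rule maximal) blast
  then show ?thesis using B(3) by blast
qed

text \<open>The maximum over the compact closure of \<open>A\<close> is positive, so it is taken
  where \<open>u\<close> does not vanish, and such a point of the closure lies in
  \<open>A\<close>.\<close>

lemma nodal_domain_attains_max:
  fixes X :: "('a::t2_space, 'n::finite) riem"
  assumes X: "smooth_manifold X" and comp: "compact (points X)"
    and u: "continuous_on (points X) u" and A: "nodal_domain X u A"
  obtains p where "p \<in> A" "\<And>q. q \<in> A \<Longrightarrow> \<bar>u q\<bar> \<le> \<bar>u p\<bar>"
proof -
  have A': "A \<noteq> {}" "A \<subseteq> points X" "\<And>q. q \<in> A \<Longrightarrow> u q \<noteq> 0"
    using A by (auto simp: nodal_domain_def connected_open_in_nonzero_def)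
  have sub: "closure A \<subseteq> points X"
    using A'(2) comp by (simp add: closure_minimal compact_imp_closed)
  have "compact (points X \<inter> closure A)" using comp by (rule compact_Int_closed) simp
  then have "compact (closure A)" using sub by (simp add: Int_absorb1)
  moreover have "continuous_on (closure A) (\<lambda>q. \<bar>u q\<bar>)"
    by (intro continuous_on_rabs continuous_on_subset[OF u sub])
  moreover have "closure A \<noteq> {}" using A' by simp
  ultimately obtain p where p: "p \<in> closure A" "\<And>q. q \<in> closure A \<Longrightarrow> \<bar>u q\<bar> \<le> \<bar>u p\<bar>"
    using continuous_attains_sup by metis
  obtain a where "a \<in> A" using A' by blast
  then have "0 < \<bar>u a\<bar>" "\<bar>u a\<bar> \<le> \<bar>u p\<bar>" using A'(3) p(2) closure_subset by auto
  then have "u p \<noteq> 0" by auto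
  then have "p \<in> A" using nodal_domain_closure[OF X u A _ p(1)] sub p(1) by blast
  then show ?thesis using that p(2) closure_subset by blast
qed

text \<open>The image of the connected set \<open>A\<close> under \<open>u\<close> is an interval
  that omits 0.\<close>

lemma nodal_domain_constant_sign:
  fixes X :: "('a::t2_space, 'n::finite) riem"
  assumes u: "continuous_on (points X) u" and A: "nodal_domain X u A" and pq: "p \<in> A" "q \<in> A"
  shows "0 < sgn (u p) * u q"
proof -
  have A': "connected A" "A \<subseteq> points X" "\<And>q. q \<in> A \<Longrightarrow> u q \<noteq> 0"
    using A by (auto simp: nodal_domain_def connected_open_in_nonzero_def)
  have "connected (u ` A)"
    using connected_continuous_image[OF continuous_on_subset[OF u A'(2)] A'(1)] .
  then have "is_interval (u ` A)" by (simp add: is_interval_connected_1)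
  moreover have "0 \<notin> u ` A" using A'(3) by force
  ultimately have "\<not> (u p \<le> 0 \<and> 0 \<le> u q)" "\<not> (u q \<le> 0 \<and> 0 \<le> u p)"
    using pq unfolding is_interval_1 by blast+
  then show ?thesis by (auto simp: sgn_if mult_less_0_iff)
qed

section \<open>Measurability and lower bounds for the Riemannian volume\<close>

lemma sets_riemannian_volume:
  assumes "atlas X \<noteq> {}" shows "sets (riemannian_volume X) = sets borel"
  unfolding riemannian_volume_def
  by (rule sets_SUP[OF _ assms]) (simp add: chart_volume_def)

text \<open>This reduces a lower volume bound to a single chart, which suffices because the contact
  points all lie in one chart.\<close>

lemma chart_volume_le_riemannian_volume:
  assumes "c \<in> atlas X"
  shows "emeasure (chart_volume X c) S \<le> emeasure (riemannian_volume X) S"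
proof (rule le_measureD3)
  show "chart_volume X c \<le> riemannian_volume X"
    unfolding riemannian_volume_def using assms by (rule SUP_upper)
  show "sets (chart_volume X c) = sets (riemannian_volume X)"
    using assms sets_riemannian_volume[of X] by (auto simp: chart_volume_def)
qed

lemma chart_img_borel:
  assumes "is_chart M k c" shows "chart_img c \<in> sets borel"
proof -
  obtain T where T: "open T" "chart_img c = half_space k \<inter> T"
    using assms by (auto simp: is_chart_def openin_open)
  have "closed (half_space k)"
    unfolding half_space_def by (rule closed_halfspace_component_ge_cart)
  then show ?thesis unfolding T(2) using T(1) by (intro sets.Int borel_closed borel_open)
qed

text \<open>Off \<open>chart_img c\<close> the map \<open>param c\<close> has a constant junk value, so it is measurable on the
  whole space; otherwise the image measure in \<open>chart_volume\<close> would be void.\<close>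

lemma param_measurable:
  assumes "is_chart M k c" shows "param c \<in> borel_measurable borel"
proof -
  \<comment> \<open>Off the image the predicate inside \<open>inv_into\<close> is unsatisfiable,
    hence the same function for every such \<open>x\<close>, and \<open>SOME\<close> returns the
    same value.\<close>
  define d where "d = (SOME y. y \<in> chart_dom c \<and> False)"
  have "param c x = d" if "x \<notin> chart_img c" for x
  proof -
    have "(\<lambda>y. y \<in> chart_dom c \<and> coord c y = x) = (\<lambda>y. y \<in> chart_dom c \<and> False)"
      using that by (auto simp: chart_img_def)
    then show ?thesis by (simp add: param_def inv_into_def d_def)
  qed
  then have "param c = (\<lambda>x. if x \<in> chart_img c then param c x else d)" by auto
  moreover have "(\<lambda>x. if x \<in> chart_img c then param c x else d) \<in> borel_measurable borel"
    using borel_measurable_continuous_on_restrict[OF is_chart_param(1)[OF assms]] chart_img_borel[OF assms]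
    by (subst (asm) measurable_restrict_space_iff) auto
  ultimately show ?thesis by simp
qed

lemma emeasure_chart_volume_ge:
  assumes X: "riemannian_manifold X" and c: "c \<in> atlas X"
    and S: "S \<in> sets borel" and E: "E \<in> sets borel" "E \<subseteq> chart_img c" "param c ` E \<subseteq> S"
    and \<nu>: "\<And>x. x \<in> E \<Longrightarrow> \<nu> \<le> volume_density X c x"
  shows "ennreal \<nu> * emeasure lborel E \<le> emeasure (chart_volume X c) S"
proof -
  have chart: "is_chart (points X) (bdry_coord X) c"
    and smooth: "smooth_on (chart_img c) (metric X c)"
    using X c by (simp_all add: riemannian_manifold_def smooth_manifold_def)
  let ?g = "\<lambda>x. ennreal (volume_density X c x) * indicator (chart_img c) x"
  have "continuous_on (chart_img c) (volume_density X c)"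
    unfolding volume_density_def det_def
    by (intro continuous_intros smooth_on_imp_continuous_on[OF smooth])
  then have "(\<lambda>x. indicator (chart_img c) x *\<^sub>R volume_density X c x) \<in> borel_measurable borel"
    using borel_measurable_continuous_on_indicator chart_img_borel[OF chart] by blast
  then have "(\<lambda>x. ennreal (indicator (chart_img c) x *\<^sub>R volume_density X c x)) \<in> borel_measurable borel"
    by measurable
  moreover have "ennreal (indicator (chart_img c) x *\<^sub>R volume_density X c x) = ?g x" for x
    by (simp add: indicator_def)
  ultimately have g: "?g \<in> borel_measurable lborel" by simp
  note pm = param_measurable[OF chart]
  have pS: "param c -` S \<in> sets borel" using measurable_sets[OF pm S] by simp
  have "ennreal \<nu> * emeasure lborel E = (\<integral>\<^sup>+x. ennreal \<nu> * indicator E x \<partial>lborel)"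
    using E(1) by (simp add: nn_integral_cmult_indicator)
  also have "\<dots> \<le> (\<integral>\<^sup>+x. ?g x * indicator (param c -` S) x \<partial>lborel)"
    using E(2,3) \<nu> by (intro nn_integral_mono) (auto simp: indicator_def intro!: ennreal_leI)
  also have "\<dots> = emeasure (density lborel ?g) (param c -` S)"
    using g pS by (simp add: emeasure_density)
  also have "\<dots> = emeasure (chart_volume X c) S"
    unfolding chart_volume_def using pm S by (subst emeasure_distr) auto
  finally show ?thesis .
qed

text \<open>Bounding the essential supremum from above is the useful direction: a smaller norm
  lowers the threshold, so \<open>superlevel\<close> contains every point of \<open>A\<close> with
  |u| at least \<delta> m when \<delta> is nonnegative.\<close>

lemma
  assumes "atlas X \<noteq> {}" and A: "A \<in> sets borel" and u: "continuous_on A u"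
    and m: "\<And>p. p \<in> A \<Longrightarrow> \<bar>u p\<bar> \<le> m"
  shows Linf_norm_le: "Linf_norm X A u \<le> ereal m"
    and superlevel_borel: "superlevel X \<delta> u A \<in> sets borel"
proof -
  have meas: "(\<lambda>p. ereal \<bar>u p\<bar>) \<in> borel_measurable (restrict_space borel A)"
    using borel_measurable_continuous_on_restrict[OF u] by measurable
  have "sets (restrict_space (riemannian_volume X) A) = sets (restrict_space borel A)"
    by (intro sets_restrict_space_cong sets_riemannian_volume assms)
  then have "(\<lambda>p. ereal \<bar>u p\<bar>) \<in> borel_measurable (restrict_space (riemannian_volume X) A)"
    using meas measurable_cong_sets by blast
  then show "Linf_norm X A u \<le> ereal m"
    unfolding Linf_norm_def using m by (intro esssup_I AE_I2) (auto simp: space_restrict_space)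
  have "{p \<in> space (restrict_space borel A). ereal \<delta> * Linf_norm X A u \<le> ereal \<bar>u p\<bar>}
      \<in> sets (restrict_space borel A)"
    using meas by measurable
  moreover have "{p \<in> space (restrict_space borel A). ereal \<delta> * Linf_norm X A u \<le> ereal \<bar>u p\<bar>} = superlevel X \<delta> u A"
    by (auto simp: superlevel_def space_restrict_space)
  ultimately show "superlevel X \<delta> u A \<in> sets borel"
    using A by (simp add: sets_restrict_space_iff)
qed


section \<open>The volume estimate\<close>

text \<open>The measure estimate is applied in the chart to the multiple of \<open>u\<close> by its
  sign on \<open>A\<close>, centred at the maximum point. The set it produces lies in the coordinate
  image of the superlevel set, and the density is at least \<open>\<nu>\<close> there.\<close>

lemma chart_superlevel_estimate:
  fixes X :: "('a::t2_space, 'n::finite) riem"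
  assumes X: "riemannian_manifold X" and comp: "compact (points X)" and c: "c \<in> atlas X"
    and sub: "half_space (bdry_coord X) \<inter> cball x0 \<rho> \<subseteq> chart_img c"
    and bounds: "\<forall>x\<in>int_img X c \<inter> cball x0 \<rho>.
      \<nu> \<le> volume_density X c x \<and> volume_density X c x \<le> C \<and>
      (\<forall>i j. laplace_coeff X c x$i$j = laplace_coeff X c x$j$i \<and> \<bar>laplace_coeff X c x$i$j\<bar> \<le> C) \<and>
      (\<forall>v. \<theta> * (v \<bullet> v) \<le> v \<bullet> (laplace_coeff X c x *v v)) \<and>
      (\<exists>b. (\<forall>i. \<bar>b$i\<bar> \<le> C) \<and> (\<forall>f. Ck_on 2 (int_img X c) f \<longrightarrow>
        - (laplace_coord X c f x * volume_density X c x) =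
        (\<Sum>i\<in>UNIV. \<Sum>j\<in>UNIV. laplace_coeff X c x$i$j * hessian f x$i$j) + b \<bullet> gradient f x))"
    and const: "0 < C" "0 < \<theta>" "0 < \<nu>" and \<delta>: "0 < \<delta>" "\<delta> < 1"
    and r: "0 < r" "r \<le> 1" "r \<le> \<rho> / 2" "0 \<le> lam" "lam * r\<^sup>2 \<le> 1"
    and u: "eigenfunction X lam u" and A: "nodal_domain X u A"
    and p: "p \<in> A" "p \<in> chart_dom c" "coord c p \<in> cball x0 (\<rho> / 2)"
    and max: "\<And>q. q \<in> A \<Longrightarrow> \<bar>u q\<bar> \<le> \<bar>u p\<bar>"
  shows "ennreal (\<nu> * abp_const CARD('n) \<theta> C \<delta> * r ^ CARD('n))
    \<le> emeasure (riemannian_volume X) (superlevel X \<delta> u A)"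
proof -
  let ?H = "half_space (bdry_coord X)" and ?I = "int_img X c"
  have man: "smooth_manifold X" using X by (simp add: riemannian_manifold_def)
  have chart: "is_chart (points X) (bdry_coord X) c"
    using man c by (simp add: smooth_manifold_def)
  note par = is_chart_param[OF chart]
  have u_cont: "continuous_on (points X) u"
    and u_C2: "Ck_on 2 ?I (u \<circ> param c)"
    and u_eq: "\<And>x. x \<in> ?I \<Longrightarrow> laplace_coord X c (u \<circ> param c) x = lam * u (param c x)"
    and u_bdry: "\<And>q. q \<in> boundary_points X \<Longrightarrow> u q = 0"
    using u c by (simp_all add: eigenfunction_def)
  have A_op: "openin (top_of_set (points X)) A" and A_sub: "A \<subseteq> points X" and A_nz: "\<And>q. q \<in> A \<Longrightarrow> u q \<noteq> 0"
    using A by (auto simp: nodal_domain_def connected_open_in_nonzero_def)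
  define m where "m = \<bar>u p\<bar>"
  define s where "s = sgn (u p)"
  define g where "g = u \<circ> param c"
  define y0 where "y0 = coord c p"
  define f where "f x = s * u (param c x)" for x
  have m: "m > 0" using A_nz[OF p(1)] by (simp add: m_def)
  have s_pos: "s * u q = \<bar>u q\<bar>" if "q \<in> A" for q
    using nodal_domain_constant_sign[OF u_cont A p(1) that]
    unfolding s_def by (auto simp: sgn_if split: if_splits)
  have s_le: "\<bar>u q\<bar> \<le> m" if "q \<in> A" for q using max[OF that] by (simp add: m_def)
  have py0: "param c y0 = p" using par(3)[OF p(2)] by (simp add: y0_def)
  have fy0: "f y0 = m" using s_pos[OF p(1)] by (simp add: f_def py0 m_def)
  define L where "L = ?H \<inter> cball y0 r"
  have near: "cball y0 r \<subseteq> cball x0 \<rho>"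
  proof
    fix x assume "x \<in> cball y0 r"
    then show "x \<in> cball x0 \<rho>"
      using dist_triangle[of x0 x y0] p(3) r by (simp add: y0_def)
  qed
  have L_img: "L \<subseteq> chart_img c" using near sub by (auto simp: L_def)
  have "closed ?H" unfolding half_space_def by (rule closed_halfspace_component_ge_cart)
  then have "compact L" unfolding L_def by (simp add: closed_Int_compact)
  have pts_closed: "closed (points X)" using comp by (rule compact_imp_closed)
  have sU_cont: "continuous_on (points X) (\<lambda>q. s * u q)" by (intro continuous_intros u_cont)
  define Q where "Q = {q \<in> A. \<delta> * m \<le> s * u q}"
  define Q' where "Q' = {q \<in> A. \<delta> * m < s * u q}"
  \<comment> \<open>Membership in \<open>A\<close> is not a closed condition, but at a point of the
    closure with \<open>s * u q \<ge> \<delta> * m > 0\<close> the function does not vanish, so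
    \<open>nodal_domain_closure\<close> returns it to \<open>A\<close>.\<close>
  have "closed Q"
  proof -
    have "closed (points X \<inter> (\<lambda>q. s * u q) -` {\<delta> * m..})"
      by (rule continuous_closed_preimage[OF sU_cont pts_closed closed_atLeast])
    moreover have "Q = closure A \<inter> (points X \<inter> (\<lambda>q. s * u q) -` {\<delta> * m..})"
    proof (intro set_eqI iffI)
      fix q assume "q \<in> Q"
      then show "q \<in> closure A \<inter> (points X \<inter> (\<lambda>q. s * u q) -` {\<delta> * m..})"
        using A_sub closure_subset[of A] by (auto simp: Q_def)
    next
      fix q assume q: "q \<in> closure A \<inter> (points X \<inter> (\<lambda>q. s * u q) -` {\<delta> * m..})"
      then have "\<delta> * m \<le> s * u q" by simp
      then have "0 < s * u q" using mult_pos_pos[OF \<delta>(1) m] by linarith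
      then have "u q \<noteq> 0" by auto
      then have "q \<in> A" using nodal_domain_closure[OF man u_cont A, of q] q by auto
      then show "q \<in> Q" using q by (simp add: Q_def)
    qed
    ultimately show ?thesis by (simp add: closed_Int)
  qed
  have "openin (top_of_set (points X)) Q'"
  proof -
    have "openin (top_of_set (points X)) (points X \<inter> (\<lambda>q. s * u q) -` {\<delta> * m<..})"
      by (rule continuous_openin_preimage_gen[OF sU_cont open_greaterThan])
    from openin_Int[OF A_op this] show ?thesis
      using A_sub by (simp add: Q'_def Int_def vimage_def subset_iff conj_commute cong: conj_cong)
  qed
  then have "openin (top_of_set (chart_img c)) (chart_img c \<inter> param c -` Q')"
    using continuous_openin_preimage[OF par(1)] par(5,7) by blast
  then obtain T where T: "open T" "chart_img c \<inter> param c -` Q' = chart_img c \<inter> T"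
    by (auto simp: openin_open)
  \<comment> \<open>\<open>Z\<close> uses the weak inequality and the closed half-ball and is
    compact; \<open>\<Omega>\<close> uses the strict inequality, the open ball and interior points
    and is open.\<close>
  define Z where "Z = L \<inter> param c -` Q"
  define \<Omega> where "\<Omega> = ?I \<inter> ball y0 r \<inter> param c -` Q'"
  have I_img: "?I \<subseteq> chart_img c" by (auto simp: int_img_def)
  have "\<Omega> = ?I \<inter> ball y0 r \<inter> T" using T(2) I_img by (auto simp: \<Omega>_def)
  then have \<Omega>_open: "open \<Omega>" using T(1) int_img_open[OF chart] by auto
  have "closed Z"
    unfolding Z_def
    by (rule continuous_closed_preimage[OF continuous_on_subset[OF par(1) L_img] compact_imp_closed[OF \<open>compact L\<close>] \<open>closed Q\<close>])
  then have Z_comp: "compact Z" using \<open>compact L\<close> by (metis Z_def compact_Int_closed inf.left_idem)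
  have \<Omega>Z: "\<Omega> \<subseteq> Z"
    using I_img par(8) by (auto simp: \<Omega>_def Z_def L_def Q_def Q'_def less_imp_le)
  have \<Omega>I: "x \<in> ?I \<inter> cball x0 \<rho>" if "x \<in> \<Omega>" for x
    using that near ball_subset_cball[of y0 r] unfolding \<Omega>_def by blast
  have f_cont: "continuous_on Z f"
  proof -
    have "Z \<subseteq> chart_img c" using L_img by (auto simp: Z_def)
    then show ?thesis
      unfolding f_def using par(5,7)
      by (intro continuous_intros continuous_on_compose2[OF u_cont continuous_on_subset[OF par(1)]]) auto
  qed
  have y0Z: "y0 \<in> Z"
    using par(4,8) p(1,2) r m \<delta> s_pos[OF p(1)]
    by (auto simp: Z_def L_def Q_def py0 y0_def[symmetric] m_def) (auto simp: y0_def)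
  have Zr: "Z \<subseteq> cball y0 r" by (auto simp: Z_def L_def)
  have Z_le: "f x \<le> f y0" if "x \<in> Z" for x
    using that s_pos s_le by (simp add: Z_def Q_def f_def[of x] fy0)
  \<comment> \<open>The Dirichlet condition enters here: a point with \<open>param c x\<close> in
    \<open>A\<close> is not on the boundary, since \<open>u\<close> vanishes there, so a point of
    \<open>Z\<close> can miss \<open>\<Omega>\<close> only through the level or the
    distance.\<close>
  have rim: "f x \<le> \<delta> * f y0 \<or> r \<le> dist y0 x" if "x \<in> Z - \<Omega>" for x
  proof (rule ccontr)
    assume "\<not> ?thesis"
    then have x: "\<delta> * m < f x" "dist y0 x < r" by (auto simp: fy0)
    have xZ: "x \<in> chart_img c" "param c x \<in> A" using that L_img by (auto simp: Z_def Q_def)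
    have "param c x \<notin> boundary_points X" using u_bdry A_nz xZ(2) by blast
    then have "coord c (param c x) $ bdry_coord X \<noteq> 0"
      using c par(5)[OF xZ(1)] by (auto simp: boundary_points_def)
    then have "x $ bdry_coord X \<noteq> 0" using par(6)[OF xZ(1)] by simp
    moreover have "0 \<le> x $ bdry_coord X" using par(8) xZ(1) by (auto simp: half_space_def)
    ultimately have "x \<in> ?I" using xZ(1) by (simp add: int_img_def)
    then have "x \<in> \<Omega>" using x xZ by (simp add: \<Omega>_def Q'_def f_def)
    then show False using that by blast
  qed
  have f_eq: "f = (\<lambda>x. s * g x)" by (simp add: f_def g_def fun_eq_iff)
  have I_open: "open ?I" by (rule int_img_open[OF chart])
  have g_C2: "Ck_on 2 ?I g" unfolding g_def by (rule u_C2)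
  define G where "G x = s *\<^sub>R gradient g x" for x
  define H where "H x = s *\<^sub>R hessian g x" for x
  have f': "(f has_derivative (\<lambda>v. G x \<bullet> v)) (at x)" if "x \<in> \<Omega>" for x
  proof -
    have "x \<in> ?I" using \<Omega>I[OF that] by blast
    from has_derivative_mult_right[OF Ck_on_2_imp_has_gradient[OF I_open g_C2 this], of s]
    show ?thesis by (simp add: f_eq G_def)
  qed
  have G': "(G has_derivative (\<lambda>v. H x *v v)) (at x)" if "x \<in> \<Omega>" for x
  proof -
    have "x \<in> ?I" using \<Omega>I[OF that] by blast
    from has_derivative_scaleR_right[OF gradient_has_derivative_hessian[OF I_open g_C2 this], of s]
    show ?thesis by (simp only: G_def[abs_def] H_def scaleR_matrix_vector_assoc)
  qed
  have H_cont: "continuous_on \<Omega> H"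
    unfolding H_def using \<Omega>I
    by (intro continuous_intros continuous_on_subset[OF continuous_on_hessian[OF g_C2]]) blast
  have "\<forall>x\<in>\<Omega>. \<exists>b. (\<forall>i. \<bar>b$i\<bar> \<le> C) \<and>
      - (laplace_coord X c g x * volume_density X c x) =
        (\<Sum>i\<in>UNIV. \<Sum>j\<in>UNIV. laplace_coeff X c x$i$j * hessian g x$i$j) + b \<bullet> gradient g x"
  proof
    fix x assume "x \<in> \<Omega>"
    from bspec[OF bounds \<Omega>I[OF this]]
    have "\<exists>b. (\<forall>i. \<bar>b$i\<bar> \<le> C) \<and> (\<forall>f. Ck_on 2 ?I f \<longrightarrow>
        - (laplace_coord X c f x * volume_density X c x) =
        (\<Sum>i\<in>UNIV. \<Sum>j\<in>UNIV. laplace_coeff X c x$i$j * hessian f x$i$j) + b \<bullet> gradient f x)"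
      by (elim conjE)
    then show "\<exists>b. (\<forall>i. \<bar>b$i\<bar> \<le> C) \<and>
      - (laplace_coord X c g x * volume_density X c x) =
        (\<Sum>i\<in>UNIV. \<Sum>j\<in>UNIV. laplace_coeff X c x$i$j * hessian g x$i$j) + b \<bullet> gradient g x"
      using g_C2 by (elim exE conjE, intro exI conjI) (assumption, simp only:)
  qed
  from bchoice[OF this] obtain b where b: "\<And>x i. x \<in> \<Omega> \<Longrightarrow> \<bar>b x$i\<bar> \<le> C"
    and b_eq: "\<And>x. x \<in> \<Omega> \<Longrightarrow> - (laplace_coord X c g x * volume_density X c x) =
        (\<Sum>i\<in>UNIV. \<Sum>j\<in>UNIV. laplace_coeff X c x$i$j * hessian g x$i$j) + b x \<bullet> gradient g x"
    by blast
  \<comment> \<open>Multiplied by the density and the sign, the eigenvalue equation has right-hand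
    side -lam times density times \<open>f\<close>, and 0 \<le> f \<le> f y0 on
    \<open>\<Omega>\<close> bounds it from below.\<close>
  have pde: "(\<Sum>i\<in>UNIV. \<Sum>j\<in>UNIV. laplace_coeff X c x$i$j * H x$i$j) + b x \<bullet> G x \<ge> - (lam * C * f y0)"
    if x: "x \<in> \<Omega>" for x
  proof -
    have xI: "x \<in> ?I" using \<Omega>I[OF x] by blast
    have "(\<Sum>i\<in>UNIV. \<Sum>j\<in>UNIV. laplace_coeff X c x$i$j * H x$i$j) + b x \<bullet> G x
        = s * ((\<Sum>i\<in>UNIV. \<Sum>j\<in>UNIV. laplace_coeff X c x$i$j * hessian g x$i$j) + b x \<bullet> gradient g x)"
      by (simp add: H_def G_def distrib_left sum_distrib_left mult.left_commute)
    also have "\<dots> = s * (- (laplace_coord X c g x * volume_density X c x))" by (simp only: b_eq[OF x])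
    also have "\<dots> = - (lam * (volume_density X c x * f x))"
      using u_eq[OF xI] by (simp add: g_def f_def mult_ac)
    finally have eq: "(\<Sum>i\<in>UNIV. \<Sum>j\<in>UNIV. laplace_coeff X c x$i$j * H x$i$j) + b x \<bullet> G x
        = - (lam * (volume_density X c x * f x))" .
    have "0 \<le> f x" "f x \<le> f y0"
      using x Z_le[of x] \<Omega>Z s_pos by (auto simp: \<Omega>_def Q'_def f_def)
    moreover have "0 \<le> volume_density X c x" "volume_density X c x \<le> C"
      using bspec[OF bounds \<Omega>I[OF x]] const by auto
    ultimately have "volume_density X c x * f x \<le> C * f y0" using const by (intro mult_mono) auto
    then have "lam * (volume_density X c x * f x) \<le> lam * (C * f y0)"
      using r by (intro mult_left_mono) auto
    then show ?thesis unfolding eq by (simp add: mult.assoc)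
  qed
  obtain E where E: "E \<in> sets borel" "E \<subseteq> \<Omega>"
    and E_ge: "ennreal (abp_const CARD('n) \<theta> C \<delta> * r ^ CARD('n)) \<le> emeasure lborel E"
    using abp_measure_estimate[where a="laplace_coeff X c" and b=b and lam=lam and C=C and \<theta>=\<theta> and \<delta>=\<delta>,
        OF \<Omega>_open \<Omega>Z Z_comp f_cont Zr y0Z Z_le rim f' G' H_cont _ _ _ b pde]
      bspec[OF bounds \<Omega>I] const \<delta> r m fy0 by auto
  have A_borel: "A \<in> sets borel"
  proof -
    obtain T where "open T" "A = points X \<inter> T" using A_op openin_open by metis
    then show ?thesis using pts_closed by (metis borel_closed borel_open sets.Int)
  qed
  have ne: "atlas X \<noteq> {}" using c by blast
  note Linf = Linf_norm_le[OF ne A_borel continuous_on_subset[OF u_cont A_sub] s_le]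
    superlevel_borel[OF ne A_borel continuous_on_subset[OF u_cont A_sub] s_le]
  have "q \<in> superlevel X \<delta> u A" if "q \<in> Q" for q
  proof -
    have "ereal \<delta> * Linf_norm X A u \<le> ereal \<delta> * ereal m"
      using \<delta> by (intro ereal_mult_left_mono Linf(1)) auto
    also have "\<dots> \<le> ereal \<bar>u q\<bar>" using that s_pos[of q] by (simp add: Q_def)
    finally show ?thesis using that by (simp add: superlevel_def Q_def)
  qed
  then have E_img: "param c ` E \<subseteq> superlevel X \<delta> u A"
    using E(2) \<Omega>Z by (auto simp: Z_def)
  have "ennreal (\<nu> * abp_const CARD('n) \<theta> C \<delta> * r ^ CARD('n))
      = ennreal \<nu> * ennreal (abp_const CARD('n) \<theta> C \<delta> * r ^ CARD('n))"
    using const r \<delta> abp_const_pos[of "CARD('n)" \<theta> C \<delta>] by (simp add: ennreal_mult[symmetric] mult.assoc)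
  also have "\<dots> \<le> ennreal \<nu> * emeasure lborel E" using E_ge by (rule mult_left_mono) simp
  also have "\<dots> \<le> emeasure (chart_volume X c) (superlevel X \<delta> u A)"
    by (rule emeasure_chart_volume_ge[OF X c Linf(2) E(1) _ E_img])
       (use E(2) \<Omega>I I_img bounds in blast)+
  also have "\<dots> \<le> emeasure (riemannian_volume X) (superlevel X \<delta> u A)"
    by (rule chart_volume_le_riemannian_volume[OF c])
  finally show ?thesis .
qed

text \<open>The constants come from one chart around \<open>p0\<close> and are uniform in the
  eigenfunction. \<open>U\<close> uses half the radius, so that the ball of radius r around any
  maximum point in \<open>U\<close> stays where the chart bounds hold.\<close>

lemma local_superlevel_estimate:
  fixes X :: "('a::t2_space, 'n::finite) riem"
  assumes X: "riemannian_manifold X" and comp: "compact (points X)" and p0: "p0 \<in> points X"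
    and \<delta>: "0 < \<delta>" "\<delta> < 1"
  shows "\<exists>U lam0 K. openin (top_of_set (points X)) U \<and> p0 \<in> U \<and> 0 < lam0 \<and> 0 < K \<and>
    (\<forall>lam u A p. lam0 \<le> lam \<longrightarrow> eigenfunction X lam u \<longrightarrow> nodal_domain X u A \<longrightarrow> p \<in> A \<inter> U \<longrightarrow>
      (\<forall>q\<in>A. \<bar>u q\<bar> \<le> \<bar>u p\<bar>) \<longrightarrow>
      ennreal (K * lam powr (- (real CARD('n) / 2))) \<le> emeasure (riemannian_volume X) (superlevel X \<delta> u A))"
proof -
  have "p0 \<in> (\<Union>c\<in>atlas X. chart_dom c)"
    using X p0 by (simp add: riemannian_manifold_def smooth_manifold_def)
  then obtain c where c: "c \<in> atlas X" "p0 \<in> chart_dom c" by (rule UN_E)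
  have chart: "is_chart (points X) (bdry_coord X) c"
    using X c by (simp add: riemannian_manifold_def smooth_manifold_def)
  note par = is_chart_param[OF chart]
  define x0 where "x0 = coord c p0"
  have "x0 \<in> chart_img c" using par(4) c by (simp add: x0_def)
  then obtain \<rho> C \<theta> \<nu> where
    pos: "\<rho> > 0" "C > 0" "\<theta> > 0" "\<nu> > 0"
    and sub: "half_space (bdry_coord X) \<inter> cball x0 \<rho> \<subseteq> chart_img c"
    and bounds: "\<forall>x\<in>int_img X c \<inter> cball x0 \<rho>.
      \<nu> \<le> volume_density X c x \<and> volume_density X c x \<le> C \<and>
      (\<forall>i j. laplace_coeff X c x$i$j = laplace_coeff X c x$j$i \<and> \<bar>laplace_coeff X c x$i$j\<bar> \<le> C) \<and>
      (\<forall>v. \<theta> * (v \<bullet> v) \<le> v \<bullet> (laplace_coeff X c x *v v)) \<and>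
      (\<exists>b. (\<forall>i. \<bar>b$i\<bar> \<le> C) \<and> (\<forall>f. Ck_on 2 (int_img X c) f \<longrightarrow>
        - (laplace_coord X c f x * volume_density X c x) =
        (\<Sum>i\<in>UNIV. \<Sum>j\<in>UNIV. laplace_coeff X c x$i$j * hessian f x$i$j) + b \<bullet> gradient f x))"
    by (rule chart_pde_bounds[OF X c(1)])
  define U where "U = chart_dom c \<inter> coord c -` ball x0 (\<rho> / 2)"
  \<comment> \<open>The first entry ensures \<open>r \<le> 1\<close>, the second
    \<open>r \<le> \<rho> / 2\<close>, for the wavelength scale
    \<open>r = 1 / sqrt lam\<close>.\<close>
  define lam0 where "lam0 = max 1 (4 / \<rho>\<^sup>2)"
  define K where "K = \<nu> * abp_const CARD('n) \<theta> C \<delta>"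
  have "openin (top_of_set (chart_dom c)) U"
    unfolding U_def by (rule continuous_openin_preimage_gen[OF par(2) open_ball])
  then have "openin (top_of_set (points X)) U"
    using chart openin_trans unfolding is_chart_def by blast
  moreover have "p0 \<in> U" using c pos by (simp add: U_def x0_def)
  moreover have "0 < lam0" by (simp add: lam0_def)
  moreover have "0 < K" unfolding K_def using pos \<delta> by (intro mult_pos_pos abp_const_pos) auto
  moreover have "ennreal (K * lam powr (- (real CARD('n) / 2))) \<le> emeasure (riemannian_volume X) (superlevel X \<delta> u A)"
    if lam: "lam0 \<le> lam" and u: "eigenfunction X lam u" "nodal_domain X u A"
      and p: "p \<in> A \<inter> U" "\<forall>q\<in>A. \<bar>u q\<bar> \<le> \<bar>u p\<bar>" for lam u A p
  proof -
    have lam1: "1 \<le> lam" "4 / \<rho>\<^sup>2 \<le> lam" using lam by (auto simp: lam0_def)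
    define r where "r = 1 / sqrt lam"
    have r0: "0 < r" "r \<le> 1" "lam * r\<^sup>2 \<le> 1" using lam1 by (auto simp: r_def power_divide)
    have "4 \<le> lam * \<rho>\<^sup>2" using lam1 pos by (simp add: pos_divide_le_eq)
    then have "sqrt 4 \<le> sqrt lam * \<rho>"
      using pos by (metis real_sqrt_le_mono real_sqrt_mult real_sqrt_abs abs_of_pos)
    then have "r \<le> \<rho> / 2" using lam1 by (simp add: r_def field_simps)
    moreover have "r ^ CARD('n) = lam powr (- (real CARD('n) / 2))"
    proof -
      have "r = lam powr (- (1 / 2))" using lam1 by (simp add: r_def powr_minus_divide powr_half_sqrt)
      then have "r ^ CARD('n) = lam powr (- (1 / 2) * real CARD('n))"
        using lam1 by (simp only: powr_powr[symmetric]) (simp add: powr_realpow)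
      then show ?thesis by simp
    qed
    moreover have "coord c p \<in> cball x0 (\<rho> / 2)" "p \<in> chart_dom c" "p \<in> A" using p by (auto simp: U_def)
    ultimately show ?thesis
      using chart_superlevel_estimate[OF X comp c(1) sub bounds pos(2-4) \<delta> r0(1,2) _ _ r0(3) u, of p] lam1 p
      by (simp add: K_def)
  qed
  ultimately show ?thesis by blast
qed

section \<open>Patching the local estimates by compactness\<close>

theorem theorem1p2p4:
  fixes X :: "('a::t2_space, 'n::finite) riem" and \<delta> :: real
  assumes "riemannian_manifold X"
    and "compact (points X)"
    and "connected (points X)"
    and "CARD('n) \<ge> 2"
    and "0 < \<delta>" and "\<delta> < 1"
  shows "\<exists>lam0>0. \<exists>K>0. \<forall>lam\<ge>lam0. eigenvalue X lam \<longrightarrow>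
    (\<forall>u A. eigenfunction X lam u \<longrightarrow> nodal_domain X u A \<longrightarrow>
      emeasure (riemannian_volume X) (superlevel X \<delta> u A)
        \<ge> ennreal (K * lam powr (- (real CARD('n) / 2))))"
proof -
  \<comment> \<open>The local estimate concerns only nodal domains with a maximum point of |u| in
    \<open>U\<close>; finitely many such patches will catch a maximum point of every nodal
    domain.\<close>
  define est where "est lam0 K U \<longleftrightarrow>
    (\<forall>lam u A p. lam0 \<le> lam \<longrightarrow> eigenfunction X lam u \<longrightarrow> nodal_domain X u A \<longrightarrow> p \<in> A \<inter> U \<longrightarrow>
      (\<forall>q\<in>A. \<bar>u q\<bar> \<le> \<bar>u p\<bar>) \<longrightarrow>
      ennreal (K * lam powr (- (real CARD('n) / 2))) \<le> emeasure (riemannian_volume X) (superlevel X \<delta> u A))"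
    for lam0 K U
  have "\<forall>p0\<in>points X. \<exists>W lam0 K. open W \<and> p0 \<in> W \<and> 0 < lam0 \<and> 0 < K \<and> est lam0 K (points X \<inter> W)"
  proof
    fix p0 assume "p0 \<in> points X"
    from local_superlevel_estimate[OF assms(1,2) this assms(5,6), folded est_def]
    obtain U lam0 K where U: "openin (top_of_set (points X)) U" "p0 \<in> U" "0 < lam0" "0 < K" "est lam0 K U"
      by blast
    obtain W where "open W" "U = points X \<inter> W" using U(1) openin_open by metis
    then show "\<exists>W lam0 K. open W \<and> p0 \<in> W \<and> 0 < lam0 \<and> 0 < K \<and> est lam0 K (points X \<inter> W)"
      using U by blast
  qed
  then obtain W \<Lambda> \<kappa> where W: "\<And>p. p \<in> points X \<Longrightarrow>
      open (W p) \<and> p \<in> W p \<and> 0 < \<Lambda> p \<and> 0 < \<kappa> p \<and> est (\<Lambda> p) (\<kappa> p) (points X \<inter> W p)"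
    by metis
  obtain F where F: "F \<subseteq> points X" "finite F" "points X \<subseteq> (\<Union>p\<in>F. W p)"
    by (rule compactE_image[OF assms(2), of "points X" W]) (use W in blast)+
  \<comment> \<open>Inserting 1 here and in \<open>K\<close> keeps the extrema over nonempty sets
    whatever \<open>F\<close> is.\<close>
  define lam0 where "lam0 = Max (insert 1 (\<Lambda> ` F))"
  define K where "K = Min (insert 1 (\<kappa> ` F))"
  have K: "0 < K" unfolding K_def using F W by (subst Min_gr_iff) auto
  have "1 \<le> lam0" unfolding lam0_def using F by (intro Max_ge) auto
  then have lam0: "0 < lam0" by linarith
  have "ennreal (K * lam powr (- (real CARD('n) / 2))) \<le> emeasure (riemannian_volume X) (superlevel X \<delta> u A)"
    if lam: "lam0 \<le> lam" and u: "eigenfunction X lam u" "nodal_domain X u A" for lam u A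
  proof -
    have man: "smooth_manifold X" using assms(1) by (simp add: riemannian_manifold_def)
    have uc: "continuous_on (points X) u" using u(1) by (simp add: eigenfunction_def)
    \<comment> \<open>The maximum point selects the patch \<open>p'\<close> whose local estimate
      applies; \<open>lam0\<close> and \<open>K\<close> are the worst constants over all
      patches.\<close>
    obtain p where p: "p \<in> A" "\<And>q. q \<in> A \<Longrightarrow> \<bar>u q\<bar> \<le> \<bar>u p\<bar>"
      using nodal_domain_attains_max[OF man assms(2) uc u(2)] by blast
    have "p \<in> points X"
      using p(1) u(2) by (auto simp: nodal_domain_def connected_open_in_nonzero_def)
    then obtain p' where p': "p' \<in> F" "p \<in> W p'" using F(3) by blast
    have "\<Lambda> p' \<le> lam0" unfolding lam0_def using F p' by (intro Max_ge) auto
    moreover have "est (\<Lambda> p') (\<kappa> p') (points X \<inter> W p')" using W F(1) p'(1) by blast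
    ultimately have "ennreal (\<kappa> p' * lam powr (- (real CARD('n) / 2)))
        \<le> emeasure (riemannian_volume X) (superlevel X \<delta> u A)"
      using lam u p p'(2) \<open>p \<in> points X\<close> unfolding est_def by (meson IntI order_trans)
    moreover have "K \<le> \<kappa> p'" unfolding K_def using F p' by (intro Min_le) auto
    then have "ennreal (K * lam powr (- (real CARD('n) / 2))) \<le> ennreal (\<kappa> p' * lam powr (- (real CARD('n) / 2)))"
      by (intro ennreal_leI mult_right_mono) auto
    ultimately show ?thesis by (rule order_trans[rotated])
  qed
  then show ?thesis using K lam0 by blast
qed

end
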